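(* The elements $T_{k_1,l_1}\odot \cdots \odot T_{k_n,l_n}$ form a basis for $\mathcal{T}$. A basis for the subspace $\mathrm{Sym}^\odot(\mathcal{S})$ is given by the subset of elements for which $k_i\geq l_i$ for all $i$.
   Context: $\mathscr{P}$ is the set of partitions and $r_m(\lambda)$ the number of parts of $\lambda$ equal to $m$. The Faulhaber polynomial $F_l$ is the polynomial with zero constant term with $F_l(n)=\sum_{i=1}^n i^{l-1}$ for $n\ge1$. For $k\ge0,l\ge1$, $k+l$ even, $T_{k,l}(\lambda)=-\frac{B_{k+l}}{2(k+l)}(\delta_{l,1}+\delta_{k,0})+\sum_{m\ge1}m^kF_l(r_m(\lambda))$; $S_k=T_{k-1,1}$ for even $k\ge2$. The induced product $\odot$ is defined by $\langle f\odot g\rangle_{\vec u}=\langle f\rangle_{\vec u}\langle g\rangle_{\vec u}$ with $\langle f\rangle_{\vec u}=\sum_\lambda f(\lambda)u_{\lambda_1}u_{\lambda_2}\cdots/\sum_\lambda u_{\lambda_1}u_{\lambda_2}\cdots$. $\mathcal{T}$ is generated by the $T_{k,l}$ under pointwise product; $\mathcal{S}$ is generated by the $S_k$ under pointwise product and $\mathrm{Sym}^\odot(\mathcal{S})$ by the elements of $\mathcal{S}$ under the induced product. Induced products differing only by a reordering of the factors are considered the same element; $n$ ranges over all $n\ge0$ and each pair $(k_i,l_i)$ satisfies $k_i\ge0$, $l_i\ge1$, $k_i+l_i$ even. *)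

theory Defs
  imports Complex_Main "HOL-Library.Multiset" "HOL-Library.Product_Lexorder" "HOL-Library.Function_Algebras"
begin

typedef partition = "{M :: nat multiset. 0 \<notin># M}"
  morphisms parts Abs_partition
  by (rule exI[of _ "{#}"]) simp

definition rmult :: "nat \<Rightarrow> partition \<Rightarrow> nat" where
  "rmult m lam = count (parts lam) m"

text \<open>Bernoulli numbers via B_0 = 1 and sum_{j=0}^{n} C(n+1,j) B_j = 0 for n >= 1
  (only even indices >= 2 are used below, so the sign convention for B_1 is irrelevant).\<close>
fun bernoulli :: "nat \<Rightarrow> rat" where
  "bernoulli n = (if n = 0 then 1 else
     - (\<Sum>j\<in>{0..<n}. of_nat ((n + 1) choose j) * (if j < n then bernoulli j else 0))
       / of_nat (n + 1))"

definition faulhaber :: "nat \<Rightarrow> nat \<Rightarrow> rat" where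
  "faulhaber l n = (\<Sum>i=1..n. of_nat i ^ (l - 1))"

definition valid_pair :: "nat \<times> nat \<Rightarrow> bool" where
  "valid_pair p \<longleftrightarrow> snd p \<ge> 1 \<and> even (fst p + snd p)"

definition kdelta :: "nat \<Rightarrow> nat \<Rightarrow> rat" where
  "kdelta a b = (if a = b then 1 else 0)"

definition Tfun :: "nat \<Rightarrow> nat \<Rightarrow> partition \<Rightarrow> rat" where
  "Tfun k l lam =
     - bernoulli (k + l) / (2 * of_nat (k + l)) * (kdelta l 1 + kdelta k 0)
     + (\<Sum>m\<in>set_mset (parts lam). of_nat m ^ k * faulhaber l (rmult m lam))"

definition Sfun :: "nat \<Rightarrow> partition \<Rightarrow> rat" where
  "Sfun k = Tfun (k - 1) 1"

text \<open>Formal power series in the variables u_1, u_2, ... are represented by their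
  coefficient functions: the coefficient of the monomial u_{lambda_1} u_{lambda_2} ...
  is indexed by the partition lambda.  Their product:\<close>
definition ser_mult :: "(partition \<Rightarrow> rat) \<Rightarrow> (partition \<Rightarrow> rat) \<Rightarrow> partition \<Rightarrow> rat" where
  "ser_mult A B lam =
     (\<Sum>\<alpha>\<in>{\<alpha>. \<alpha> \<subseteq># parts lam}. A (Abs_partition \<alpha>) * B (Abs_partition (parts lam - \<alpha>)))"

text \<open>Z = sum over all partitions of u_lambda.\<close>
definition Zser :: "partition \<Rightarrow> rat" where
  "Zser = (\<lambda>_. 1)"

text \<open>The u-bracket: <f>_u = (sum_lambda f(lambda) u_lambda) / Z, i.e. the series X with X Z = F.\<close>
definition ubracket :: "(partition \<Rightarrow> rat) \<Rightarrow> partition \<Rightarrow> rat" where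
  "ubracket f = (THE X. ser_mult X Zser = f)"

definition odot :: "(partition \<Rightarrow> rat) \<Rightarrow> (partition \<Rightarrow> rat) \<Rightarrow> partition \<Rightarrow> rat" where
  "odot f g = (THE h. ubracket h = ser_mult (ubracket f) (ubracket g))"

text \<open>Unit for the induced product (empty induced product): the constant function 1,
  whose u-bracket is the series 1.\<close>
definition odot_list :: "(partition \<Rightarrow> rat) list \<Rightarrow> partition \<Rightarrow> rat" where
  "odot_list fs = foldr odot fs (\<lambda>_. 1)"

definition fscale :: "rat \<Rightarrow> (partition \<Rightarrow> rat) \<Rightarrow> partition \<Rightarrow> rat" where
  "fscale c f = (\<lambda>x. c * f x)"

definition TT :: "(partition \<Rightarrow> rat) set" where
  "TT = module.span fscale
     {(\<lambda>x. \<Prod>p\<in>#M. Tfun (fst p) (snd p) x) | M. \<forall>p\<in>#M. valid_pair p}"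

definition SS :: "(partition \<Rightarrow> rat) set" where
  "SS = module.span fscale
     {(\<lambda>x. \<Prod>k\<in>#K. Sfun k x) | K. \<forall>k\<in>#K. even k \<and> k \<ge> 2}"

definition SymS :: "(partition \<Rightarrow> rat) set" where
  "SymS = module.span fscale {odot_list fs | fs. set fs \<subseteq> SS}"

text \<open>The induced product T_{k_1,l_1} odot ... odot T_{k_n,l_n}, indexed by the multiset
  of pairs (k_i,l_i) (reorderings give the same element).\<close>
definition Tbasis :: "(nat \<times> nat) multiset \<Rightarrow> partition \<Rightarrow> rat" where
  "Tbasis M = odot_list (map (\<lambda>p. Tfun (fst p) (snd p)) (sorted_list_of_multiset M))"

end

theory Submission
  imports Defs "HOL-Computational_Algebra.Polynomial"
begin

text \<open>
  The bracket of \<open>T k l\<close> is a constant plus the series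
  \<open>\<Sum>m s. m\<^sup>k s\<^bsup>l-1\<^esup> u\<^sub>m\<^sup>s\<close>, so induced products become ordinary products of power series.

  Independence: in a product of \<open>n\<close> such series, the coefficients at monomials with \<open>n\<close> distinct
  variables are the symmetrised products of the \<open>m\<^sup>k s\<^bsup>l-1\<^esup>\<close>, and products of fewer factors do not
  contribute there; peeling off one variable at a time reduces the claim to the independence of the
  functions \<open>m\<^sup>k s\<^bsup>l-1\<^esup>\<close>.

  Generation of \<open>TT\<close>: since \<open>(T k l \<odot> f)(\<lambda>)\<close> is a constant multiple of \<open>f \<lambda>\<close> plus
  \<open>\<Sum>m s. m\<^sup>k s\<^bsup>l-1\<^esup> f (\<lambda> - m\<^sup>s)\<close>, multiplying a pointwise product of \<open>n\<close> generators by a further generator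
  pointwise or by \<open>\<odot>\<close> makes a difference only in terms with at most \<open>n\<close> factors. That these terms
  involve only pairs of even sum comes from the reflection \<open>r \<mapsto> -1 - r\<close> of the Faulhaber polynomials.
  The only property of the constant terms that matters is that they vanish for \<open>k \<ge> 1\<close>, \<open>l \<ge> 2\<close>.

  Generation of \<open>SymS\<close>: pointwise multiplication by \<open>T k 1\<close> is \<open>T k 1 \<odot> -\<close> plus the \<open>\<odot>\<close>-derivation
  that acts on brackets as \<open>\<Sum>m. m\<^sup>k u\<^sub>m \<partial>/\<partial>u\<^sub>m\<close> and maps \<open>T a l\<close> to \<open>T (a + k) (l + 1)\<close>. As \<open>k \<ge> 1\<close>, the pairs
  with \<open>a \<ge> l\<close> are preserved, and \<open>T\<^sub>1\<^sub>,\<^sub>1\<^sup>i T\<^sub>a\<^sub>,\<^sub>1\<close> equals \<open>T\<^sub>a\<^sub>+\<^sub>i\<^sub>,\<^sub>i\<^sub>+\<^sub>1\<close> up to induced products of generators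
  with smaller second index.
\<close>

section \<open>Power series indexed by partitions\<close>

instantiation partition :: cancel_comm_monoid_add
begin

definition zero_partition :: partition where "0 = Abs_partition {#}"
definition plus_partition :: "partition \<Rightarrow> partition \<Rightarrow> partition"
  where "a + b = Abs_partition (parts a + parts b)"
definition minus_partition :: "partition \<Rightarrow> partition \<Rightarrow> partition"
  where "a - b = Abs_partition (parts a - parts b)"

lemma zero_notin_parts [simp]: "0 \<notin># parts a"
  using parts[of a] by simp

lemma parts_zero [simp]: "parts 0 = {#}"
  by (simp add: zero_partition_def Abs_partition_inverse)

lemma parts_plus [simp]: "parts (a + b) = parts a + parts b"
  by (simp add: plus_partition_def Abs_partition_inverse)

lemma parts_minus [simp]: "parts (a - b) = parts a - parts b"
proof -
  have "0 \<notin># parts a - parts b" by (meson in_diffD zero_notin_parts)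
  then show ?thesis by (simp add: minus_partition_def Abs_partition_inverse)
qed

instance
  by standard (simp_all add: parts_inject[symmetric] ac_simps)

end

lemma parts_eq_empty_iff [simp]: "parts a = {#} \<longleftrightarrow> a = 0"
  by (metis parts_inject parts_zero)

lemma parts_Abs_partition_subset: "parts (Abs_partition \<alpha>) = \<alpha>" if "\<alpha> \<subseteq># parts a"
  using that by (intro Abs_partition_inverse) (auto dest: mset_subset_eqD)

lemma Abs_partition_parts_diff: "Abs_partition (parts a - \<alpha>) = a - Abs_partition \<alpha>" if "\<alpha> \<subseteq># parts a"
  using that by (simp add: minus_partition_def parts_Abs_partition_subset)

lemma finite_submultisets [simp]: "finite {\<alpha>. \<alpha> \<subseteq># M}"
proof (induction M)
  case (add x M)
  have "\<alpha> \<in> {\<alpha>. \<alpha> \<subseteq># M} \<union> add_mset x ` {\<alpha>. \<alpha> \<subseteq># M}" if "\<alpha> \<subseteq># add_mset x M" for \<alpha>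
  proof (cases "x \<in># \<alpha>")
    case True
    then obtain \<beta> where "\<alpha> = add_mset x \<beta>" by (metis insert_DiffM)
    then show ?thesis using that by auto
  next
    case False
    then have "\<alpha> \<subseteq># M" using that
      by (metis diff_single_trivial subset_eq_diff_conv add_mset_add_single)
    then show ?thesis by simp
  qed
  then show ?case
    by (rule_tac finite_subset[of _ "{\<alpha>. \<alpha> \<subseteq># M} \<union> add_mset x ` {\<alpha>. \<alpha> \<subseteq># M}"]) (use add in auto)
qed simp

lemma Abs_partition_plus_diff: "Abs_partition \<alpha> + (a - Abs_partition \<alpha>) = a" if "\<alpha> \<subseteq># parts a"
  using that by (subst parts_inject[symmetric]) (simp add: parts_Abs_partition_subset)

text \<open>A submultiset of the parts together with its complement is a decomposition of
  \<open>lam\<close>. In this symmetric form commutativity and associativity are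
  reindexings.\<close>

lemma ser_mult_eq:
  "ser_mult A B lam = (\<Sum>(\<mu>, \<nu>)\<in>{(\<mu>, \<nu>). \<mu> + \<nu> = lam}. A \<mu> * B \<nu>)"
  unfolding ser_mult_def
  by (rule sum.reindex_bij_witness[where j = "\<lambda>\<alpha>. (Abs_partition \<alpha>, Abs_partition (parts lam - \<alpha>))"
        and i = "\<lambda>x. parts (fst x)"])
     (auto simp: parts_inverse Abs_partition_parts_diff parts_Abs_partition_subset
        Abs_partition_plus_diff)

lemma finite_sum_decompositions [simp]: "finite {x. fst x + snd x = (lam :: partition)}"
proof (rule finite_subset)
  show "{x. fst x + snd x = lam} \<subseteq> (\<lambda>\<alpha>. (Abs_partition \<alpha>, lam - Abs_partition \<alpha>)) ` {\<alpha>. \<alpha> \<subseteq># parts lam}"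
  proof clarify
    fix \<mu> \<nu> :: partition
    show "(\<mu>, \<nu>) \<in> (\<lambda>\<alpha>. (Abs_partition \<alpha>, fst (\<mu>, \<nu>) + snd (\<mu>, \<nu>) - Abs_partition \<alpha>)) `
        {\<alpha>. \<alpha> \<subseteq># parts (fst (\<mu>, \<nu>) + snd (\<mu>, \<nu>))}"
      by (rule image_eqI[of _ _ "parts \<mu>"]) (simp_all add: parts_inverse)
  qed
  show "finite ((\<lambda>\<alpha>. (Abs_partition \<alpha>, lam - Abs_partition \<alpha>)) ` {\<alpha>. \<alpha> \<subseteq># parts lam})" by simp
qed

lemma ser_mult_commute: "ser_mult A B = ser_mult B A"
  by (rule ext, unfold ser_mult_eq,
      rule sum.reindex_bij_witness[where i = prod.swap and j = prod.swap])
     (auto simp: ac_simps)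

lemma ser_mult_assoc: "ser_mult (ser_mult A B) C = ser_mult A (ser_mult B C)"
proof
  fix lam
  have "ser_mult (ser_mult A B) C lam =
     (\<Sum>x\<in>{(\<mu>, \<nu>). \<mu> + \<nu> = lam}. \<Sum>y\<in>{(\<alpha>, \<beta>). \<alpha> + \<beta> = fst x}. A (fst y) * B (snd y) * C (snd x))"
    by (simp add: ser_mult_eq sum_distrib_right case_prod_unfold)
  also have "\<dots> = (\<Sum>(x, y)\<in>(SIGMA x:{(\<mu>, \<nu>). \<mu> + \<nu> = lam}. {(\<alpha>, \<beta>). \<alpha> + \<beta> = fst x}).
      A (fst y) * B (snd y) * C (snd x))"
    by (subst sum.Sigma) (simp_all add: case_prod_unfold)
  \<comment> \<open>Both index sets enumerate the triples of partitions with sum \<open>lam\<close>;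
    the maps only move the brackets.\<close>
  also have "\<dots> = (\<Sum>(x, y)\<in>(SIGMA x:{(\<mu>, \<nu>). \<mu> + \<nu> = lam}. {(\<alpha>, \<beta>). \<alpha> + \<beta> = snd x}).
      A (fst x) * (B (fst y) * C (snd y)))"
    by (rule sum.reindex_bij_witness
        [where i = "\<lambda>(x, y). ((fst x + fst y, snd y), (fst x, fst y))"
          and j = "\<lambda>(x, y). ((fst y, snd y + snd x), (snd y, snd x))"])
       (auto simp: ac_simps)
  also have "\<dots> = (\<Sum>x\<in>{(\<mu>, \<nu>). \<mu> + \<nu> = lam}. \<Sum>y\<in>{(\<alpha>, \<beta>). \<alpha> + \<beta> = snd x}. A (fst x) * (B (fst y) * C (snd y)))"
    by (subst sum.Sigma) (simp_all add: case_prod_unfold)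
  also have "\<dots> = ser_mult A (ser_mult B C) lam"
    by (simp add: ser_mult_eq sum_distrib_left case_prod_unfold)
  finally show "ser_mult (ser_mult A B) C lam = ser_mult A (ser_mult B C) lam" .
qed

lemma ser_mult_add_right: "ser_mult A (B + C) = ser_mult A B + ser_mult A C"
  by (rule ext) (simp add: ser_mult_def sum.distrib distrib_left)

lemma ser_mult_scale_right: "ser_mult A (fscale c B) = fscale c (ser_mult A B)"
  by (rule ext) (simp add: ser_mult_def fscale_def sum_distrib_left mult_ac)

lemma ser_mult_add_left: "ser_mult (A + B) C = ser_mult A C + ser_mult B C"
  by (simp add: ser_mult_commute[of _ C] ser_mult_add_right)

lemma ser_mult_scale_left: "ser_mult (fscale c A) B = fscale c (ser_mult A B)"
  by (simp add: ser_mult_commute[of _ B] ser_mult_scale_right)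

definition ser_one :: "partition \<Rightarrow> rat" where
  "ser_one = (\<lambda>\<mu>. if \<mu> = 0 then 1 else 0)"

lemma Abs_partition_eq_zero: "Abs_partition \<alpha> = 0 \<longleftrightarrow> \<alpha> = {#}" if "\<alpha> \<subseteq># parts a"
  using parts_Abs_partition_subset[OF that] by (metis parts_eq_empty_iff)

lemma ser_mult_one_left [simp]: "ser_mult ser_one A = A"
proof
  fix lam
  have "ser_mult ser_one A lam = (\<Sum>\<alpha>\<in>{{#}}. ser_one (Abs_partition \<alpha>) * A (Abs_partition (parts lam - \<alpha>)))"
    unfolding ser_mult_def
    by (rule sum.mono_neutral_right) (auto simp: ser_one_def Abs_partition_eq_zero)
  then show "ser_mult ser_one A lam = A lam"
    by (simp add: ser_one_def parts_inverse zero_partition_def)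
qed

text \<open>Inverting \<^const>\<open>Zser\<close>: the guard in the recursive call lets the termination proof see that
  the summation index is a proper submultiset.\<close>

function zdiv :: "(partition \<Rightarrow> rat) \<Rightarrow> nat multiset \<Rightarrow> rat" where
  "zdiv f M = f (Abs_partition M) - (\<Sum>\<alpha>\<in>{\<alpha>. \<alpha> \<subset># M}. if \<alpha> \<subset># M then zdiv f \<alpha> else 0)"
  by auto
termination
  by (relation "measure (size \<circ> snd)") (auto simp: mset_subset_size)

declare zdiv.simps [simp del]

lemma ser_mult_Zser: "ser_mult A Zser lam = (\<Sum>\<alpha>\<in>{\<alpha>. \<alpha> \<subseteq># parts lam}. A (Abs_partition \<alpha>))"
  by (simp add: ser_mult_def Zser_def)

lemma subset_mset_insert: "{\<alpha>. \<alpha> \<subseteq># M} = insert M {\<alpha>. \<alpha> \<subset># M}"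
  by auto

lemma finite_psubset_mset [simp]: "finite {\<alpha>. \<alpha> \<subset># M}"
  by (rule finite_subset[of _ "{\<alpha>. \<alpha> \<subseteq># M}"]) auto

lemma ser_mult_Zser_split:
  "ser_mult A Zser lam = A lam + (\<Sum>\<alpha>\<in>{\<alpha>. \<alpha> \<subset># parts lam}. A (Abs_partition \<alpha>))"
  unfolding ser_mult_Zser subset_mset_insert by (simp add: parts_inverse)

lemma ser_mult_zdiv: "ser_mult (zdiv f \<circ> parts) Zser = f"
proof
  fix lam
  have "(\<Sum>\<alpha>\<in>{\<alpha>. \<alpha> \<subset># parts lam}. (zdiv f \<circ> parts) (Abs_partition \<alpha>)) =
      (\<Sum>\<alpha>\<in>{\<alpha>. \<alpha> \<subset># parts lam}. if \<alpha> \<subset># parts lam then zdiv f \<alpha> else 0)"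
    by (rule sum.cong) (auto simp: parts_Abs_partition_subset[OF subset_mset.less_imp_le])
  then show "ser_mult (zdiv f \<circ> parts) Zser lam = f lam"
    by (simp add: ser_mult_Zser_split zdiv.simps[of f "parts lam"] parts_inverse)
qed

text \<open>\<open>Zser\<close> has constant term 1, so the coefficient of the product at
  \<open>M\<close> is that of \<open>A\<close> plus values of \<open>A\<close> at proper
  submultisets; induction on the size recovers \<open>A\<close>. With \<open>ser_mult_zdiv\<close>
  this gives the quotient in \<open>ubracket\<close> existence and uniqueness.\<close>

lemma ser_mult_Zser_inj: "A = B" if "ser_mult A Zser = ser_mult B Zser"
proof -
  have "A (Abs_partition M) = B (Abs_partition M)" if "0 \<notin># M" for M
    using that
  proof (induction "size M" arbitrary: M rule: less_induct)
    case less
    have M: "parts (Abs_partition M) = M" using less.prems by (simp add: Abs_partition_inverse)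
    have "(\<Sum>\<alpha>\<in>{\<alpha>. \<alpha> \<subset># M}. A (Abs_partition \<alpha>)) = (\<Sum>\<alpha>\<in>{\<alpha>. \<alpha> \<subset># M}. B (Abs_partition \<alpha>))"
      using less.prems
      by (intro sum.cong less.hyps) (auto simp: mset_subset_size dest: mset_subset_eqD subset_mset.less_imp_le)
    moreover have "ser_mult A Zser (Abs_partition M) = ser_mult B Zser (Abs_partition M)"
      using \<open>ser_mult A Zser = ser_mult B Zser\<close> by simp
    ultimately show ?case by (simp add: ser_mult_Zser_split M)
  qed
  from this[of "parts _"] show ?thesis by (intro ext) (simp add: parts_inverse)
qed

section \<open>The u-bracket and the induced product\<close>

lemma ubracket_eqI: "ubracket f = X" if "ser_mult X Zser = f"
  unfolding ubracket_def by (rule the_equality[of _ X]) (use that ser_mult_Zser_inj in auto)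

lemma ser_mult_ubracket [simp]: "ser_mult (ubracket f) Zser = f"
  using ubracket_eqI[OF ser_mult_zdiv] ser_mult_zdiv by metis

lemma ubracket_ser_mult [simp]: "ubracket (ser_mult X Zser) = X"
  by (rule ubracket_eqI) simp

lemma ubracket_inject [simp]: "ubracket f = ubracket g \<longleftrightarrow> f = g"
  by (metis ser_mult_ubracket)

text \<open>Multiplying the product of the two brackets by \<open>Zser\<close> turns one of them
  back into its function. Hence only one factor needs a known bracket, and linearity is inherited
  from \<open>ser_mult\<close>.\<close>

lemma odot_eq: "odot f g = ser_mult (ubracket f) g"
proof -
  have *: "ser_mult (ubracket f) g = ser_mult (ser_mult (ubracket f) (ubracket g)) Zser"
    by (simp add: ser_mult_assoc)
  show ?thesis unfolding odot_def
    by (rule the_equality) (auto simp: *, metis ser_mult_ubracket)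
qed

lemma ubracket_odot: "ubracket (odot f g) = ser_mult (ubracket f) (ubracket g)"
  by (rule ubracket_eqI) (simp add: odot_eq ser_mult_assoc)

lemma odot_commute: "odot f g = odot g f"
  by (metis ubracket_inject ubracket_odot ser_mult_commute)

lemma odot_assoc: "odot (odot f g) h = odot f (odot g h)"
  by (metis ubracket_inject ubracket_odot ser_mult_assoc)

lemma odot_left_commute: "odot f (odot g h) = odot g (odot f h)"
  by (metis odot_assoc odot_commute)

lemma ubracket_one [simp]: "ubracket (\<lambda>_. 1) = ser_one"
  by (rule ubracket_eqI) (simp add: Zser_def)

lemma odot_one_left [simp]: "odot (\<lambda>_. 1) f = f"
  by (simp add: odot_eq)

lemma odot_one_right [simp]: "odot f (\<lambda>_. 1) = f"
  by (metis odot_commute odot_one_left)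

lemma odot_add_right: "odot f (g + h) = odot f g + odot f h"
  by (simp add: odot_eq ser_mult_add_right)

lemma odot_scale_right: "odot f (fscale c g) = fscale c (odot f g)"
  by (simp add: odot_eq ser_mult_scale_right)

lemma ubracket_add: "ubracket (f + g) = ubracket f + ubracket g"
  by (rule ubracket_eqI) (simp add: ser_mult_add_left)

lemma ubracket_scale: "ubracket (fscale c f) = fscale c (ubracket f)"
  by (rule ubracket_eqI) (simp add: ser_mult_scale_left)

interpretation F: vector_space fscale
  by standard (auto simp: fscale_def fun_eq_iff algebra_simps)

lemma odot_add_left: "odot (f + g) h = odot f h + odot g h"
  by (metis odot_commute odot_add_right)

lemma odot_scale_left: "odot (fscale c f) g = fscale c (odot f g)"
  by (metis odot_commute odot_scale_right)

lemma ubracket_zero [simp]: "ubracket 0 = 0"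
  by (metis F.scale_zero_left ubracket_scale)

lemma odot_list_append: "odot_list (fs @ gs) = odot (odot_list fs) (odot_list gs)"
  by (induction fs) (simp_all add: odot_list_def odot_assoc)

text \<open>Makes the sorting in \<open>Tbasis\<close> immaterial: any factor can be split off
  first.\<close>

lemma foldr_odot_insort: "foldr odot (map h (insort p ps)) e = odot (h p) (foldr odot (map h ps) e)"
  by (induction ps) (simp_all add: odot_left_commute)

lemma Tbasis_add_mset: "Tbasis (add_mset p M) = odot (Tfun (fst p) (snd p)) (Tbasis M)"
  by (simp add: Tbasis_def odot_list_def foldr_odot_insort)

lemma Tbasis_empty [simp]: "Tbasis {#} = (\<lambda>_. 1)"
  by (simp add: Tbasis_def odot_list_def)

lemma Tbasis_plus: "Tbasis (M + N) = odot (Tbasis M) (Tbasis N)"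
  by (induction M) (simp_all add: Tbasis_add_mset odot_assoc)

section \<open>Brackets of the generators\<close>

declare bernoulli.simps [simp del]

text \<open>Stands for the monomial u_m^s. For \<open>m = 0\<close> and \<open>s > 0\<close> the
  value is unspecified, whence the hypotheses \<open>m > 0\<close> below.\<close>

definition rect :: "nat \<Rightarrow> nat \<Rightarrow> partition" where
  "rect m s = Abs_partition (replicate_mset s m)"

lemma parts_rect: "m > 0 \<Longrightarrow> parts (rect m s) = replicate_mset s m"
  unfolding rect_def by (rule Abs_partition_inverse) (auto simp: in_replicate_mset)

text \<open>The series c + sum of h m s u_m^s over m, s \<ge> 1. A power of a single variable is
  recognised by its one distinct part, which \<open>Max\<close> extracts, and its exponent is the
  size.\<close>

definition rect_ser :: "rat \<Rightarrow> (nat \<Rightarrow> nat \<Rightarrow> rat) \<Rightarrow> partition \<Rightarrow> rat" where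
  "rect_ser c h \<mu> = (if \<mu> = 0 then c
     else if card (set_mset (parts \<mu>)) = 1 then h (Max (set_mset (parts \<mu>))) (size (parts \<mu>)) else 0)"

lemma rect_ser_zero [simp]: "rect_ser c h 0 = c"
  by (simp add: rect_ser_def)

lemma rect_eq_zero_iff: "m > 0 \<Longrightarrow> rect m s = 0 \<longleftrightarrow> s = 0"
  by (metis parts_eq_empty_iff parts_rect replicate_mset_0 size_replicate_mset size_empty)

lemma rect_ser_rect [simp]: "m > 0 \<Longrightarrow> s > 0 \<Longrightarrow> rect_ser c h (rect m s) = h m s"
  by (simp add: rect_ser_def rect_eq_zero_iff parts_rect)

lemma rect_ser_cases:
  assumes "\<And>m s. m > 0 \<Longrightarrow> s > 0 \<Longrightarrow> \<mu> \<noteq> rect m s" "\<mu> \<noteq> 0"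
  shows "rect_ser c h \<mu> = 0"
proof -
  have False if "card (set_mset (parts \<mu>)) = 1"
  proof -
    from that obtain m where m: "set_mset (parts \<mu>) = {m}" by (auto simp: card_1_singleton_iff)
    then have eq: "parts \<mu> = replicate_mset (size (parts \<mu>)) m" by (metis set_mset_subset_singletonD subset_refl size_replicate_mset)
    have "m > 0" using m zero_notin_parts[of \<mu>] by (cases m) auto
    moreover from eq this have "\<mu> = rect m (size (parts \<mu>))"
      by (simp add: parts_inject[symmetric] parts_rect)
    moreover have "size (parts \<mu>) > 0" using m by (auto simp: nonempty_has_size[symmetric])
    ultimately show False using assms(1) by blast
  qed
  then show ?thesis using assms(2) by (auto simp: rect_ser_def)
qed

lemma parts_pos: "m \<in># parts lam \<Longrightarrow> m > 0"
  using zero_notin_parts[of lam] by (cases m) auto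

text \<open>Among the submultisets of the parts only the empty one and the rectangles carry a
  coefficient, and a rectangle fits exactly when \<open>s\<close> does not exceed the multiplicity
  of \<open>m\<close>.\<close>

lemma ser_mult_rect_ser:
  "ser_mult (rect_ser c h) g lam =
     c * g lam + (\<Sum>m\<in>set_mset (parts lam). \<Sum>s=1..rmult m lam. h m s * g (lam - rect m s))"
proof -
  let ?R = "SIGMA m:set_mset (parts lam). {1..rmult m lam}"
  let ?f = "\<lambda>\<alpha>. rect_ser c h (Abs_partition \<alpha>) * g (Abs_partition (parts lam - \<alpha>))"
  let ?r = "\<lambda>(m, s). replicate_mset s (m :: nat)"
  have sub: "?r ` ?R \<subseteq> {\<alpha>. \<alpha> \<subseteq># parts lam}"
    by (auto simp: rmult_def count_le_replicate_mset_subset_eq)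
  \<comment> \<open>This relies on \<open>s \<ge> 1\<close>: for \<open>s = 0\<close> every
    \<open>m\<close> would give the empty multiset.\<close>
  have inj: "inj_on ?r ?R"
  proof (rule inj_onI, clarify)
    fix m s m' s' assume "s \<in> {1..rmult m lam}" "replicate_mset s m = replicate_mset s' m'"
    moreover from this have "s = s'" by (metis size_replicate_mset)
    ultimately show "m = m' \<and> s = s'"
      by (metis atLeastAtMost_iff not_one_le_zero set_mset_replicate_mset_subset singleton_insert_inj_eq')
  qed
  have "ser_mult (rect_ser c h) g lam = sum ?f (insert {#} (?r ` ?R))"
    unfolding ser_mult_def
  proof (rule sum.mono_neutral_right)
    show "\<forall>\<alpha>\<in>{\<alpha>. \<alpha> \<subseteq># parts lam} - insert {#} (?r ` ?R). ?f \<alpha> = 0"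
    proof
      fix \<alpha> assume \<alpha>: "\<alpha> \<in> {\<alpha>. \<alpha> \<subseteq># parts lam} - insert {#} (?r ` ?R)"
      then have p: "parts (Abs_partition \<alpha>) = \<alpha>" by (auto simp: parts_Abs_partition_subset)
      have "rect_ser c h (Abs_partition \<alpha>) = 0"
      proof (rule rect_ser_cases)
        fix m s :: nat assume ms: "m > 0" "s > 0"
        show "Abs_partition \<alpha> \<noteq> rect m s"
        proof
          assume "Abs_partition \<alpha> = rect m s"
          then have eq: "\<alpha> = replicate_mset s m" using p parts_rect[OF ms(1)] by metis
          then have "s \<le> rmult m lam"
            using \<alpha> by (simp add: rmult_def count_le_replicate_mset_subset_eq)
          moreover from this have "m \<in># parts lam"
            using ms by (simp add: rmult_def flip: count_greater_zero_iff)
          ultimately have "(m, s) \<in> ?R" using ms by auto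
          then show False using \<alpha> eq by auto
        qed
      next
        show "Abs_partition \<alpha> \<noteq> 0" using \<alpha> by (auto simp: Abs_partition_eq_zero)
      qed
      then show "?f \<alpha> = 0" by simp
    qed
  qed (use sub in auto)
  also have "\<dots> = ?f {#} + sum ?f (?r ` ?R)"
  proof (rule sum.insert)
    show "{#} \<notin> ?r ` ?R"
    proof clarify
      fix m s assume "{#} = replicate_mset s m" "s \<in> {1..rmult m lam}"
      then show False using size_replicate_mset[of s m] by (metis atLeastAtMost_iff not_one_le_zero size_empty)
    qed
  qed (intro finite_imageI finite_SigmaI; simp)
  also have "?f {#} = c * g lam"
    by (simp add: parts_inverse flip: zero_partition_def)
  also have "sum ?f (?r ` ?R) = (\<Sum>(m, s)\<in>?R. h m s * g (lam - rect m s))"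
    unfolding sum.reindex[OF inj] comp_def
  proof (rule sum.cong[OF refl], clarify)
    fix m s assume *: "m \<in># parts lam" "s \<in> {1..rmult m lam}"
    then have "replicate_mset s m \<subseteq># parts lam"
      by (simp add: rmult_def count_le_replicate_mset_subset_eq)
    then show "?f (replicate_mset s m) = h m s * g (lam - rect m s)"
      using * parts_pos[OF *(1)] by (simp add: Abs_partition_parts_diff flip: rect_def)
  qed
  also have "\<dots> = (\<Sum>m\<in>set_mset (parts lam). \<Sum>s=1..rmult m lam. h m s * g (lam - rect m s))"
    by (rule sum.Sigma[symmetric]) auto
  finally show ?thesis .
qed

abbreviation Tf :: "nat \<times> nat \<Rightarrow> partition \<Rightarrow> rat" where
  "Tf p \<equiv> Tfun (fst p) (snd p)"

definition Tconst :: "nat \<times> nat \<Rightarrow> rat" where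
  "Tconst p = - bernoulli (fst p + snd p) / (2 * of_nat (fst p + snd p)) * (kdelta (snd p) 1 + kdelta (fst p) 0)"

definition Tweight :: "nat \<times> nat \<Rightarrow> nat \<Rightarrow> nat \<Rightarrow> rat" where
  "Tweight p m s = of_nat m ^ fst p * of_nat s ^ (snd p - 1)"

lemma Tf_eq: "Tf p lam = Tconst p + (\<Sum>m\<in>set_mset (parts lam). of_nat m ^ fst p * faulhaber (snd p) (rmult m lam))"
  by (simp add: Tfun_def Tconst_def)

text \<open>Multiplication by \<open>Zser\<close> adds up the coefficients of all u_m^s dividing the
  given monomial, and for fixed \<open>m\<close> the powers of \<open>s\<close> up to the
  multiplicity add up to the Faulhaber value.\<close>

lemma ubracket_Tf: "ubracket (Tf p) = rect_ser (Tconst p) (Tweight p)"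
  by (rule ubracket_eqI, rule ext)
     (simp add: ser_mult_rect_ser Zser_def Tf_eq faulhaber_def Tweight_def sum_distrib_left)

lemma odot_Tf: "odot (Tf p) g lam =
    Tconst p * g lam + (\<Sum>m\<in>set_mset (parts lam). \<Sum>s=1..rmult m lam. Tweight p m s * g (lam - rect m s))"
  by (simp add: odot_eq ubracket_Tf ser_mult_rect_ser)

lemma rmult_diff_rect:
  "m > 0 \<Longrightarrow> rmult m' (lam - rect m s) = (if m' = m then rmult m lam - s else rmult m' lam)"
  by (simp add: rmult_def parts_rect)

section \<open>Linear independence\<close>

text \<open>A polynomial with infinitely many roots has zero coefficients; several \<open>p\<close>
  may share an exponent, hence the sum over a fibre of \<open>e\<close>.\<close>

lemma power_sum_eq_zero:
  fixes d :: "'a \<Rightarrow> rat"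
  assumes "finite P" "infinite A" "\<And>x. x \<in> A \<Longrightarrow> (\<Sum>p\<in>P. d p * of_nat x ^ e p) = 0"
  shows "(\<Sum>p\<in>{p\<in>P. e p = j}. d p) = 0"
proof -
  define q where "q = (\<Sum>p\<in>P. monom (d p) (e p))"
  have "poly q (of_nat x) = 0" if "x \<in> A" for x
    using assms(3)[OF that] by (simp add: q_def poly_sum poly_monom)
  then have "of_nat ` A \<subseteq> {x. poly q x = 0}" by auto
  moreover have "infinite (of_nat ` A :: rat set)"
    using assms(2) by (subst finite_image_iff) (auto simp: inj_on_def)
  ultimately have "q = 0" using poly_roots_finite finite_subset by blast
  then have "coeff q j = 0" by simp
  then show ?thesis
    using assms(1) by (simp add: q_def coeff_sum sum.inter_filter)
qed

text \<open>Comparing coefficients first in \<open>r\<close>, then in \<open>m\<close>, isolates one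
  exponent pair. Since second indices are positive, \<open>snd p - 1\<close> determines
  \<open>snd p\<close>.\<close>

lemma Tweight_independent:
  assumes "finite P" "infinite A" "infinite B" "\<And>p. p \<in> P \<Longrightarrow> snd p \<ge> 1"
    and zero: "\<And>m r. m \<in> A \<Longrightarrow> r \<in> B \<Longrightarrow> (\<Sum>p\<in>P. d p * Tweight p m r) = 0"
    and "p \<in> P"
  shows "d p = 0"
proof -
  let ?Q = "{q\<in>P. snd q - 1 = snd p - 1}"
  have "(\<Sum>q\<in>?Q. d q * of_nat m ^ fst q) = 0" if m: "m \<in> A" for m
  proof (rule power_sum_eq_zero[OF assms(1,3)])
    fix r assume "r \<in> B"
    from zero[OF m this] show "(\<Sum>q\<in>P. d q * of_nat m ^ fst q * of_nat r ^ (snd q - 1)) = 0"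
      by (simp only: Tweight_def mult.assoc)
  qed
  from power_sum_eq_zero[OF _ assms(2) this, of "fst p"] assms(1)
  have "(\<Sum>q\<in>{q\<in>?Q. fst q = fst p}. d q) = 0" by simp
  moreover have "{q\<in>?Q. fst q = fst p} = {p}"
  proof (rule set_eqI)
    fix q
    have "snd q = snd p" if "q \<in> P" "snd q - 1 = snd p - 1"
      using that assms(4)[OF that(1)] assms(4)[OF \<open>p \<in> P\<close>] by linarith
    then show "q \<in> {q\<in>?Q. fst q = fst p} \<longleftrightarrow> q \<in> {p}"
      using \<open>p \<in> P\<close> by (cases p; cases q) auto
  qed
  ultimately show ?thesis by simp
qed

section \<open>Leading coefficients of products of brackets\<close>

definition distinct_parts :: "partition \<Rightarrow> nat" where
  "distinct_parts lam = card (set_mset (parts lam))"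

lemma set_parts_diff_rect:
  assumes "m > 0"
  shows "set_mset (parts (lam - rect m s)) =
     (if s < rmult m lam then set_mset (parts lam) else set_mset (parts lam) - {m})"
  using assms by (auto simp: parts_rect rmult_def in_diff_count split: if_splits simp flip: count_greater_zero_iff)

lemma distinct_parts_diff_rect:
  assumes "m \<in># parts lam"
  shows "distinct_parts (lam - rect m s) =
     (if s < rmult m lam then distinct_parts lam else distinct_parts lam - 1)"
  using assms parts_pos[OF assms] by (simp add: distinct_parts_def set_parts_diff_rect del: parts_minus)

abbreviation Tser :: "(nat \<times> nat) multiset \<Rightarrow> partition \<Rightarrow> rat" where
  "Tser M \<equiv> ubracket (Tbasis M)"

lemma Tser_add_mset: "Tser (add_mset p M) lam = Tconst p * Tser M lam +
    (\<Sum>m\<in>set_mset (parts lam). \<Sum>s=1..rmult m lam. Tweight p m s * Tser M (lam - rect m s))"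
  by (simp add: Tbasis_add_mset ubracket_odot ubracket_Tf ser_mult_rect_ser)

text \<open>Every term of a factor involves at most one variable, so a monomial of the product has
  at most as many distinct variables as there are factors.\<close>

lemma Tser_eq_zero: "size M < distinct_parts lam \<Longrightarrow> Tser M lam = 0"
proof (induction M arbitrary: lam)
  case empty
  then show ?case by (auto simp: ser_one_def distinct_parts_def)
next
  case (add p M)
  have "Tser M (lam - rect m s) = 0" if "m \<in># parts lam" for m s
    by (rule add.IH) (use add.prems that in \<open>auto simp: distinct_parts_diff_rect\<close>)
  then have "(\<Sum>m\<in>set_mset (parts lam). \<Sum>s=1..rmult m lam. Tweight p m s * Tser M (lam - rect m s)) = 0"
    by (intro sum.neutral ballI) simp
  moreover have "Tser M lam = 0" using add.prems by (intro add.IH) simp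
  ultimately show ?case unfolding Tser_add_mset by simp
qed

text \<open>The new factor must use up one part completely: its constant term, or a power below the
  full multiplicity, would leave the other factors with too many distinct parts.\<close>

lemma Tser_add_mset_top:
  assumes "distinct_parts lam = Suc (size M)"
  shows "Tser (add_mset p M) lam =
    (\<Sum>m\<in>set_mset (parts lam). Tweight p m (rmult m lam) * Tser M (lam - rect m (rmult m lam)))"
proof -
  have "(\<Sum>s=1..rmult m lam. Tweight p m s * Tser M (lam - rect m s)) =
      Tweight p m (rmult m lam) * Tser M (lam - rect m (rmult m lam))" if "m \<in># parts lam" for m
  proof -
    have "rmult m lam \<ge> 1" using that by (simp add: rmult_def Suc_le_eq)
    moreover have "Tser M (lam - rect m s) = 0" if "s < rmult m lam" for s
      by (rule Tser_eq_zero) (use assms that \<open>m \<in># parts lam\<close> in \<open>simp add: distinct_parts_diff_rect\<close>)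
    ultimately show ?thesis
      by (subst sum.remove[of _ "rmult m lam"]) (auto intro!: sum.neutral)
  qed
  then show ?thesis using assms by (simp add: Tser_add_mset Tser_eq_zero)
qed

lemma sum_sum_mset_swap: "(\<Sum>x\<in>A. \<Sum>y\<in>#N. f x y) = (\<Sum>y\<in>#N. \<Sum>x\<in>A. (f x y :: 'a :: comm_monoid_add))"
  by (induction N) (simp_all add: sum.distrib)

lemma sum_mset_eq_sum_count:
  fixes f :: "'a \<Rightarrow> 'b :: comm_semiring_1"
  assumes "finite P" "set_mset N \<subseteq> P"
  shows "(\<Sum>p\<in>#N. f p) = (\<Sum>p\<in>P. of_nat (count N p) * f p)"
  using assms(2)
proof (induction N)
  case (add x N)
  have "(\<Sum>p\<in>P. of_nat (count (add_mset x N) p) * f p) =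
      (\<Sum>p\<in>P. (if p = x then f p else 0) + of_nat (count N p) * f p)"
    by (rule sum.cong) (auto simp: algebra_simps)
  then show ?case using add assms(1) by (simp add: sum.distrib)
qed simp

text \<open>The leading coefficients of a product of \<^const>\<open>Tf\<close> series are obtained by
  choosing the factor that contributes the fresh part.\<close>

lemma Tser_plus_rect:
  assumes "m > 0" "r > 0" "m \<notin># parts lam" "size M = Suc (distinct_parts lam)"
  shows "Tser M (lam + rect m r) = (\<Sum>p\<in>#M. Tweight p m r * Tser (M - {#p#}) lam)"
  using assms(3,4)
proof (induction M arbitrary: lam)
  case empty
  then show ?case by simp
next
  case (add q N)
  let ?lam' = "lam + rect m r"
  have p': "parts ?lam' = parts lam + replicate_mset r m" using assms(1) by (simp add: parts_rect)
  have set': "set_mset (parts ?lam') = insert m (set_mset (parts lam))"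
    using p' assms(2) by auto
  have dp: "distinct_parts ?lam' = Suc (size N)"
    using add.prems unfolding distinct_parts_def set' by simp
  have rm: "rmult m ?lam' = r" "\<And>m'. m' \<in># parts lam \<Longrightarrow> rmult m' ?lam' = rmult m' lam"
  proof -
    have "count (parts lam) m = 0" using add.prems(1) by (simp only: not_in_iff)
    then show "rmult m ?lam' = r" by (simp only: rmult_def p' count_union count_replicate_mset) simp
    show "rmult m' ?lam' = rmult m' lam" if "m' \<in># parts lam" for m'
    proof -
      have "m \<noteq> m'" using that add.prems(1) by blast
      then show ?thesis by (simp only: rmult_def p' count_union count_replicate_mset) simp
    qed
  qed
  have IH: "Tser N (?lam' - rect m' (rmult m' lam)) =
      (\<Sum>p\<in>#N. Tweight p m r * Tser (N - {#p#}) (lam - rect m' (rmult m' lam)))" if m': "m' \<in># parts lam" for m'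
  proof -
    have eq: "?lam' - rect m' (rmult m' lam) = (lam - rect m' (rmult m' lam)) + rect m r"
    proof -
      have "replicate_mset (rmult m' lam) m' \<subseteq># parts lam"
        unfolding rmult_def by (metis count_le_replicate_mset_subset_eq order_refl)
      then have "parts ?lam' - parts (rect m' (rmult m' lam)) =
          (parts lam - parts (rect m' (rmult m' lam))) + replicate_mset r m"
        unfolding p' parts_rect[OF parts_pos[OF m']] by (rule subset_mset.diff_add_assoc2)
      then show ?thesis
        by (simp only: parts_inject[symmetric] parts_minus parts_plus parts_rect[OF assms(1)])
    qed
    have notin: "m \<notin># parts (lam - rect m' (rmult m' lam))"
      using add.prems(1) in_diffD unfolding parts_minus by metis
    have "size N = Suc (distinct_parts (lam - rect m' (rmult m' lam)))"
    proof -
      have "distinct_parts lam > 0" using m' by (auto simp: distinct_parts_def card_gt_0_iff)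
      then show ?thesis using add.prems(2) unfolding distinct_parts_diff_rect[OF m'] by simp
    qed
    then show ?thesis unfolding eq by (rule add.IH[OF notin])
  qed
  have top: "(\<Sum>m'\<in>set_mset (parts lam). Tweight q m' (rmult m' lam) * Tser (N - {#p#}) (lam - rect m' (rmult m' lam)))
      = Tser (add_mset q N - {#p#}) lam" if "p \<in># N" for p
  proof -
    have "add_mset q N - {#p#} = add_mset q (N - {#p#})" using that by simp
    moreover have "distinct_parts lam = Suc (size (N - {#p#}))"
    proof -
      have "size N = Suc (size (N - {#p#}))" using that by (metis insert_DiffM size_add_mset)
      then show ?thesis using add.prems(2) by simp
    qed
    ultimately show ?thesis by (simp only: Tser_add_mset_top)
  qed
  \<comment> \<open>Either \<open>q\<close> takes the fresh part, or it takes an old part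
    \<open>m'\<close> and the induction hypothesis gives the fresh part to some \<open>p\<close> in
    \<open>N\<close>; \<open>top\<close> then reassembles the remaining factors.\<close>
  have "Tser (add_mset q N) ?lam' = Tweight q m r * Tser N (?lam' - rect m r) +
     (\<Sum>m'\<in>set_mset (parts lam). Tweight q m' (rmult m' ?lam') * Tser N (?lam' - rect m' (rmult m' ?lam')))"
    unfolding Tser_add_mset_top[OF dp] set'
    by (subst sum.insert[OF finite_set_mset add.prems(1)]) (simp only: rm(1))
  also have "?lam' - rect m r = lam" by simp
  also have "(\<Sum>m'\<in>set_mset (parts lam). Tweight q m' (rmult m' ?lam') * Tser N (?lam' - rect m' (rmult m' ?lam'))) =
     (\<Sum>m'\<in>set_mset (parts lam). \<Sum>p\<in>#N. Tweight p m r *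
        (Tweight q m' (rmult m' lam) * Tser (N - {#p#}) (lam - rect m' (rmult m' lam))))"
    by (rule sum.cong[OF refl]) (simp only: rm(2) IH sum_mset_distrib_left mult.left_commute)
  also have "\<dots> = (\<Sum>p\<in>#N. Tweight p m r * (\<Sum>m'\<in>set_mset (parts lam).
        Tweight q m' (rmult m' lam) * Tser (N - {#p#}) (lam - rect m' (rmult m' lam))))"
    by (simp only: sum_sum_mset_swap sum_distrib_left)
  also have "\<dots> = (\<Sum>p\<in>#N. Tweight p m r * Tser (add_mset q N - {#p#}) lam)"
    by (intro arg_cong[of _ _ sum_mset] image_mset_cong) (simp only: top)
  finally show ?case by simp
qed

text \<open>Induction on \<open>n\<close>, evaluating at \<open>lam + rect m r\<close> with
  \<open>m\<close> fresh. By \<open>Tser_plus_rect\<close> the relation becomes one between the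
  weights of the pairs, whose coefficients are relations among products with one factor
  fewer.\<close>

lemma Tser_independent_top:
  assumes "finite C" "\<And>M. M \<in> C \<Longrightarrow> size M = n \<and> (\<forall>p\<in>#M. snd p \<ge> 1)"
    and "\<And>lam. distinct_parts lam = n \<Longrightarrow> (\<Sum>M\<in>C. c M * Tser M lam) = 0"
  shows "\<forall>M\<in>C. c M = 0"
  using assms
proof (induction n arbitrary: C c)
  case 0
  show ?case
  proof
    fix M assume "M \<in> C"
    then have "C = {{#}}" "M = {#}" using 0(2) by auto
    then show "c M = 0" using 0(3)[of 0] by (simp add: ser_one_def distinct_parts_def)
  qed
next
  case (Suc n)
  define P where "P = (\<Union>M\<in>C. set_mset M)"
  have P: "finite P" "\<And>p. p \<in> P \<Longrightarrow> snd p \<ge> 1" using Suc.prems by (auto simp: P_def)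
  \<comment> \<open>This is the coefficient of \<open>Tweight p m r\<close>; infinitely many
    \<open>m\<close> remain because only finitely many parts are excluded.\<close>
  have *: "(\<Sum>M\<in>C. c M * (of_nat (count M p) * Tser (M - {#p#}) lam)) = 0"
    if lam: "distinct_parts lam = n" and p: "p \<in> P" for lam p
  proof (rule Tweight_independent[OF P(1) _ _ P(2) _ p])
    have "{m. m \<notin># parts lam \<and> m > 0} = UNIV - insert 0 (set_mset (parts lam))" by auto
    then show "infinite {m. m \<notin># parts lam \<and> m > 0}"
      by (metis Diff_infinite_finite finite_insert finite_set_mset infinite_UNIV_nat)
    show "infinite {r :: nat. r > 0}" by (metis infinite_Ioi greaterThan_def)
    fix m r assume "m \<in> {m. m \<notin># parts lam \<and> m > 0}" "r \<in> {r :: nat. r > 0}"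
    then have mr: "m > 0" "r > 0" "m \<notin># parts lam" by auto
    have "set_mset (parts (lam + rect m r)) = insert m (set_mset (parts lam))"
      using mr by (auto simp: parts_rect)
    then have "distinct_parts (lam + rect m r) = Suc n"
      using mr lam by (simp add: distinct_parts_def)
    then have "0 = (\<Sum>M\<in>C. c M * Tser M (lam + rect m r))" using Suc.prems(3) by simp
    also have "\<dots> = (\<Sum>M\<in>C. \<Sum>p\<in>P. c M * (of_nat (count M p) * Tser (M - {#p#}) lam) * Tweight p m r)"
    proof (rule sum.cong[OF refl])
      fix M assume M: "M \<in> C"
      have "Tser M (lam + rect m r) = (\<Sum>p\<in>#M. Tweight p m r * Tser (M - {#p#}) lam)"
        by (rule Tser_plus_rect[OF mr]) (use Suc.prems(2)[OF M] lam in simp)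
      also have "\<dots> = (\<Sum>p\<in>P. of_nat (count M p) * (Tweight p m r * Tser (M - {#p#}) lam))"
        by (rule sum_mset_eq_sum_count[OF P(1)]) (use M in \<open>auto simp: P_def\<close>)
      finally show "c M * Tser M (lam + rect m r) =
          (\<Sum>p\<in>P. c M * (of_nat (count M p) * Tser (M - {#p#}) lam) * Tweight p m r)"
        by (simp add: sum_distrib_left mult_ac)
    qed
    also have "\<dots> = (\<Sum>p\<in>P. (\<Sum>M\<in>C. c M * (of_nat (count M p) * Tser (M - {#p#}) lam)) * Tweight p m r)"
      by (subst sum.swap) (simp add: sum_distrib_right)
    finally show "(\<Sum>p\<in>P. (\<Sum>M\<in>C. c M * (of_nat (count M p) * Tser (M - {#p#}) lam)) * Tweight p m r) = 0" ..
  qed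
  show ?case
  proof
    fix M assume M: "M \<in> C"
    then have "M \<noteq> {#}" using Suc.prems(2) by force
    then obtain p N where pN: "M = add_mset p N" by (meson multiset_cases)
    have p: "p \<in> P" unfolding P_def using M pN by (metis UN_I union_single_eq_member)
    define C' where "C' = {N. add_mset p N \<in> C}"
    have "C' \<subseteq> (\<lambda>M. M - {#p#}) ` C" by (force simp: C'_def)
    then have fin: "finite C'" using Suc.prems(1) finite_surj by blast
    \<comment> \<open>Any of the equal copies of \<open>p\<close> may take the fresh part, so the
      coefficient picks up the multiplicity of \<open>p\<close>, which is positive and can be
      cancelled.\<close>
    have "\<forall>N\<in>C'. c (add_mset p N) * of_nat (count (add_mset p N) p) = 0"
    proof (rule Suc.IH[OF fin])
      show "size N = n \<and> (\<forall>p\<in>#N. snd p \<ge> 1)" if "N \<in> C'" for N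
        using that Suc.prems(2)[of "add_mset p N"] by (auto simp: C'_def)
      fix lam assume lam: "distinct_parts lam = n"
      have "(\<Sum>N\<in>C'. c (add_mset p N) * of_nat (count (add_mset p N) p) * Tser N lam) =
          (\<Sum>M\<in>{M\<in>C. p \<in># M}. c M * (of_nat (count M p) * Tser (M - {#p#}) lam))"
        by (rule sum.reindex_bij_witness[where i = "\<lambda>M. M - {#p#}" and j = "add_mset p"])
           (auto simp: C'_def)
      also have "\<dots> = (\<Sum>M\<in>C. c M * (of_nat (count M p) * Tser (M - {#p#}) lam))"
        by (rule sum.mono_neutral_left) (use Suc.prems(1) in \<open>auto simp: not_in_iff\<close>)
      also have "\<dots> = 0" by (rule *[OF lam p])
      finally show "(\<Sum>N\<in>C'. c (add_mset p N) * of_nat (count (add_mset p N) p) * Tser N lam) = 0" .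
    qed
    then have "c (add_mset p N) * of_nat (count (add_mset p N) p) = 0" using M pN by (simp add: C'_def)
    then show "c M = 0" unfolding pN by (simp del: of_nat_Suc)
  qed
qed

lemma fun_sum_apply: "(\<Sum>x\<in>A. f x) y = (\<Sum>x\<in>A. (f x y :: 'a :: comm_monoid_add))"
  by (induction A rule: infinite_finite_induct) simp_all

lemma ubracket_sum: "ubracket (\<Sum>x\<in>A. f x) = (\<Sum>x\<in>A. ubracket (f x))"
proof (induction A rule: infinite_finite_induct)
  case (insert x A)
  then show ?case by (subst (1 2) sum.insert) (auto simp: ubracket_add)
next
  case (infinite A)
  then show ?case by (metis sum.infinite ubracket_zero)
next
  case empty
  show ?case by (metis sum.empty ubracket_zero)
qed

text \<open>In a nontrivial relation let \<open>n\<close> be the largest size with a nonzero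
  coefficient. At partitions with \<open>n\<close> distinct parts the smaller products vanish,
  leaving a relation of uniform size.\<close>

lemma Tbasis_independent:
  assumes "finite C" "\<And>M p. M \<in> C \<Longrightarrow> p \<in># M \<Longrightarrow> snd p \<ge> 1"
    and "(\<Sum>M\<in>C. fscale (c M) (Tbasis M)) = 0"
  shows "\<forall>M\<in>C. c M = 0"
proof (rule ccontr)
  assume *: "\<not> (\<forall>M\<in>C. c M = 0)"
  define n where "n = Max (size ` {M\<in>C. c M \<noteq> 0})"
  have "n \<in> size ` {M\<in>C. c M \<noteq> 0}" unfolding n_def by (rule Max_in) (use assms(1) * in auto)
  then obtain M where M: "M \<in> C" "c M \<noteq> 0" "size M = n" by auto
  have le: "size M \<le> n" if "M \<in> C" "c M \<noteq> 0" for M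
    unfolding n_def by (rule Max_ge) (use assms(1) that in auto)
  have "\<forall>M\<in>{M\<in>C. size M = n}. c M = 0"
  proof (rule Tser_independent_top)
    fix lam assume lam: "distinct_parts lam = n"
    have "(\<Sum>M\<in>C. fscale (c M) (Tser M)) = 0"
      using arg_cong[OF assms(3), of ubracket] by (simp add: ubracket_sum ubracket_scale)
    then have "0 = (\<Sum>M\<in>C. c M * Tser M lam)"
      by (metis (no_types, lifting) fscale_def fun_sum_apply sum.cong zero_fun_apply)
    also have "\<dots> = (\<Sum>M\<in>{M\<in>C. size M = n}. c M * Tser M lam)"
    proof (rule sum.mono_neutral_right)
      show "\<forall>M\<in>C - {M\<in>C. size M = n}. c M * Tser M lam = 0"
        using le lam by (metis (mono_tags, lifting) DiffE Tser_eq_zero le_neq_implies_less mem_Collect_eq mult_eq_0_iff)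
    qed (use assms(1) in auto)
    finally show "(\<Sum>M\<in>{M\<in>C. size M = n}. c M * Tser M lam) = 0" ..
  qed (use assms(1,2) in auto)
  with M show False by auto
qed

text \<open>Independence of the indexed family yields both claims; a coincidence of two elements
  would be a relation with coefficients 1 and -1.\<close>

lemma Tbasis_inj_independent:
  assumes "\<And>M p. M \<in> I \<Longrightarrow> p \<in># M \<Longrightarrow> snd p \<ge> 1"
  shows "inj_on Tbasis I" and "\<not> F.dependent (Tbasis ` I)"
proof -
  show inj: "inj_on Tbasis I"
  proof (rule inj_onI, rule ccontr)
    fix M N assume MN: "M \<in> I" "N \<in> I" "Tbasis M = Tbasis N" "M \<noteq> N"
    define c where "c = (\<lambda>K. if K = M then 1 else - 1 :: rat)"
    have "\<forall>K\<in>{M, N}. c K = 0"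
      by (rule Tbasis_independent) (use MN assms in \<open>auto simp: c_def fscale_def fun_eq_iff\<close>)
    then show False by (simp add: c_def)
  qed
  show "\<not> F.dependent (Tbasis ` I)"
  proof
    assume "F.dependent (Tbasis ` I)"
    then obtain t u v where t: "finite t" "t \<subseteq> Tbasis ` I" "(\<Sum>v\<in>t. fscale (u v) v) = 0" "v \<in> t" "u v \<noteq> 0"
      unfolding F.dependent_explicit by blast
    obtain C where C: "C \<subseteq> I" "finite C" "t = Tbasis ` C"
      using finite_subset_image[OF t(1,2)] by blast
    have "inj_on Tbasis C" using inj C(1) inj_on_subset by blast
    then have "(\<Sum>M\<in>C. fscale (u (Tbasis M)) (Tbasis M)) = 0"
      using t(3) by (simp add: C(3) sum.reindex)
    then have "\<forall>M\<in>C. u (Tbasis M) = 0"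
      by (rule Tbasis_independent[OF C(2), rotated]) (use assms C(1) in blast)
    then show False using t(4,5) C(3) by auto
  qed
qed

section \<open>Faulhaber polynomials\<close>

text \<open>The coefficient of x^j in (x + 1/2)^b - (x - 1/2)^b.\<close>

definition central_coeff :: "nat \<Rightarrow> nat \<Rightarrow> rat" where
  "central_coeff b j = (if odd (b - j) then 2 * of_nat (b choose j) * (1/2) ^ (b - j) else 0)"

lemma faulhaber_Suc: "faulhaber l (Suc r) = faulhaber l r + of_nat (Suc r) ^ (l - 1)"
  by (simp add: faulhaber_def)

lemma faulhaber_0 [simp]: "faulhaber l 0 = 0"
  by (simp add: faulhaber_def)

lemma central_difference:
  fixes x :: rat
  shows "(x + 1/2) ^ b - (x - 1/2) ^ b = (\<Sum>j<b. central_coeff b j * x ^ j)"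
proof -
  have "(x + 1/2) ^ b - (x + - (1/2)) ^ b =
      (\<Sum>j\<le>b. of_nat (b choose j) * x ^ j * ((1/2) ^ (b - j) - (- (1/2)) ^ (b - j)))"
    by (simp only: binomial_ring[of x] right_diff_distrib sum_subtractf)
  also have "\<dots> = (\<Sum>j\<le>b. central_coeff b j * x ^ j)"
  proof (rule sum.cong[OF refl])
    fix j
    show "of_nat (b choose j) * x ^ j * ((1/2) ^ (b - j) - (- (1/2)) ^ (b - j)) = central_coeff b j * x ^ j"
      by (cases "even (b - j)") (simp_all add: central_coeff_def power_minus_odd)
  qed
  also have "\<dots> = (\<Sum>j<b. central_coeff b j * x ^ j)"
    by (simp add: lessThan_Suc_atMost[symmetric] central_coeff_def)
  finally show ?thesis by simp
qed

text \<open>The central differences at 1, ..., \<open>r\<close> telescope. Only indices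
  \<open>Suc j\<close> of the same parity as \<open>b\<close> contribute, which is the source of all
  later parity statements.\<close>

lemma power_eq_sum_faulhaber:
  "(of_nat r + 1/2) ^ b - (1/2) ^ b = (\<Sum>j<b. central_coeff b j * faulhaber (Suc j) r)"
proof (induction r)
  case (Suc r)
  have step: "(of_nat (Suc r) + 1/2 :: rat) ^ b - (of_nat (Suc r) - 1/2) ^ b =
      (\<Sum>j<b. central_coeff b j * of_nat (Suc r) ^ j)"
    by (rule central_difference)
  have "of_nat (Suc r) - 1/2 = (of_nat r + 1/2 :: rat)" by simp
  note step' = step[unfolded this]
  have tel: "A - B = S \<Longrightarrow> B - c = T \<Longrightarrow> A - c = T + S" for A B S T c :: rat by simp
  have "(of_nat (Suc r) + 1/2 :: rat) ^ b - (1/2) ^ b =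
     (\<Sum>j<b. central_coeff b j * faulhaber (Suc j) r) + (\<Sum>j<b. central_coeff b j * of_nat (Suc r) ^ j)"
    by (rule tel[OF step' Suc])
  then show ?case
    by (simp only: faulhaber_Suc distrib_left sum.distrib diff_Suc_1)
qed simp

lemma poly_eq_if_agree_on_shifted_nats:
  fixes p q :: "rat poly"
  assumes "\<And>n. poly p (of_nat n + a) = poly q (of_nat n + a)"
  shows "p = q"
proof -
  have "range (\<lambda>n. of_nat n + a) \<subseteq> {x. poly (p - q) x = 0}" using assms by auto
  moreover have "infinite (range (\<lambda>n. of_nat n + a))"
    by (rule range_inj_infinite) (simp add: inj_on_def)
  ultimately have "p - q = 0" using poly_roots_finite finite_subset by blast
  then show ?thesis by simp
qed

text \<open>For \<open>b = l\<close> the last term of \<open>power_eq_sum_faulhaber\<close> is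
  \<open>l\<close> times the wanted value, so the identity can be solved for it recursively.\<close>

lemma faulhaber_poly_exists:
  assumes "l \<ge> 1"
  shows "\<exists>Q. \<forall>r. faulhaber l r = poly Q (of_nat r + 1/2)"
  using assms
proof (induction l rule: less_induct)
  case (less l)
  then obtain k where k: "l = Suc k" by (cases l) auto
  have "\<forall>j\<in>{..<k}. \<exists>Q. \<forall>r. faulhaber (Suc j) r = poly Q (of_nat r + 1/2)"
    using less.IH k by auto
  then obtain Q where Q: "\<And>j r. j < k \<Longrightarrow> faulhaber (Suc j) r = poly (Q j) (of_nat r + 1/2)"
    by (metis lessThan_iff)
  define P where "P = smult (1 / of_nat l)
    (monom 1 l - [:(1/2) ^ l:] - (\<Sum>j<k. smult (central_coeff l j) (Q j)))"
  have "faulhaber l r = poly P (of_nat r + 1/2)" for r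
  proof -
    have "(of_nat r + 1/2) ^ l - (1/2) ^ l =
        (\<Sum>j<k. central_coeff l j * faulhaber (Suc j) r) + of_nat l * faulhaber l r"
      unfolding power_eq_sum_faulhaber by (simp add: k central_coeff_def)
    moreover have "(\<Sum>j<k. central_coeff l j * faulhaber (Suc j) r) =
        (\<Sum>j<k. central_coeff l j * poly (Q j) (of_nat r + 1/2))"
      by (rule sum.cong) (simp_all add: Q)
    ultimately have "of_nat l * faulhaber l r =
        (of_nat r + 1/2) ^ l - (1/2) ^ l - (\<Sum>j<k. central_coeff l j * poly (Q j) (of_nat r + 1/2))"
      by simp
    then have "faulhaber l r = ((of_nat r + 1/2) ^ l - (1/2) ^ l
        - (\<Sum>j<k. central_coeff l j * poly (Q j) (of_nat r + 1/2))) / of_nat l"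
      using less.prems by (simp add: field_simps)
    then show ?thesis by (simp add: P_def poly_monom poly_sum)
  qed
  then show ?case by blast
qed

text \<open>Being antiderivatives of the monomials, these polynomials inherit a reflection symmetry about
  \<open>r = -1/2\<close>; for \<open>l \<ge> 2\<close> the constant of integration is right because the polynomial vanishes
  at both \<open>r = 0\<close> and \<open>r = -1\<close>.\<close>

lemma faulhaber_poly_parity:
  assumes "l \<ge> 1"
  obtains Q where "\<And>r. faulhaber l r = poly Q (of_nat r + 1/2)"
    and "\<And>j. coeff Q j \<noteq> 0 \<Longrightarrow> even (j + l) \<or> (l = 1 \<and> j = 0)"
proof (cases "l = 1")
  case True
  \<comment> \<open>In the variable x = r + 1/2 this is x - 1/2, whose constant coefficient is the
    exception to parity.\<close>
  show ?thesis
  proof (rule that[of "[:-1/2, 1:]"])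
    show "faulhaber l r = poly [:-1/2, 1:] (of_nat r + 1/2)" for r
      by (simp add: True faulhaber_def)
    show "even (j + l) \<or> (l = 1 \<and> j = 0)" if "coeff [:-1/2, 1 :: rat:] j \<noteq> 0" for j
      using that True by (auto simp: coeff_pCons split: nat.splits)
  qed
next
  case False
  then have l: "l \<ge> 2" using assms by simp
  obtain Q where Q: "\<And>r. faulhaber l r = poly Q (of_nat r + 1/2)"
    using faulhaber_poly_exists[OF assms] by blast
  have "Q - pcompose Q [:-1, 1:] = [:-1/2, 1:] ^ (l - 1)"
  \<comment> \<open>The shift 3/2 makes both x and x - 1 of the form natural number plus
    1/2.\<close>
  proof (rule poly_eq_if_agree_on_shifted_nats[where a = "3/2"])
    fix n
    have "poly Q (of_nat n + 3/2) = faulhaber l (Suc n)" by (simp add: Q add_ac)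
    moreover have "poly Q (of_nat n + 1/2) = faulhaber l n" by (simp add: Q)
    ultimately show "poly (Q - pcompose Q [:-1, 1:]) (of_nat n + 3/2) =
        poly ([:-1/2, 1:] ^ (l - 1)) (of_nat n + 3/2)"
      by (simp add: poly_pcompose poly_power faulhaber_Suc add_ac)
  qed
  then have diff: "poly Q x - poly Q (x - 1) = (x - 1/2) ^ (l - 1)" for x
  proof -
    have "poly (Q - pcompose Q [:-1, 1:]) x = poly ([:-1/2, 1:] ^ (l - 1)) x"
      by (simp only: \<open>Q - pcompose Q [:-1, 1:] = [:-1/2, 1:] ^ (l - 1)\<close>)
    then show ?thesis by (simp add: poly_pcompose)
  qed
  have Q0: "poly Q (1/2) = 0" using Q[of 0] by simp
  have Q1: "poly Q (-1/2) = 0" using diff[of "1/2"] Q0 l by (simp add: power_0_left)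
  \<comment> \<open>\<open>R\<close> measures the failure of the reflection symmetry. It has period
    1 and vanishes at 1/2, hence has infinitely many roots.\<close>
  define R where "R = Q - smult ((-1) ^ l) (pcompose Q [:0, -1:])"
  have R: "poly R x = poly Q x - (-1) ^ l * poly Q (- x)" for x
    by (simp add: R_def poly_pcompose)
  have Rstep: "poly R x = poly R (x - 1)" for x
  proof -
    have "poly Q (1 - x) = poly Q (- x) + (1/2 - x) ^ (l - 1)"
      using diff[of "1 - x"] by simp
    moreover have "(1/2 - x) ^ (l - 1) = (-1) ^ (l - 1) * (x - 1/2) ^ (l - 1)"
      by (simp flip: power_mult_distrib)
    moreover have "(-1) ^ l * (-1) ^ (l - 1) = (-1 :: rat)"
      using l by (cases l) (simp_all flip: power_mult_distrib)
    ultimately show ?thesis using diff[of x]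
      by (simp add: R algebra_simps) (simp flip: mult.assoc)
  qed
  have "R = 0"
  proof (rule poly_eq_if_agree_on_shifted_nats[where a = "1/2"])
    fix n
    show "poly R (of_nat n + 1/2) = poly 0 (of_nat n + 1/2)"
    proof (induction n)
      case 0
      show ?case using Q0 Q1 by (simp add: R)
    next
      case (Suc n)
      then show ?case using Rstep[of "of_nat (Suc n) + 1/2"] by (simp add: add_ac)
    qed
  qed
  then have refl: "coeff Q j = (-1) ^ l * ((-1) ^ j * coeff Q j)" for j
    by (metis R_def coeff_pcompose_linear coeff_smult eq_iff_diff_eq_0)
  have "coeff Q j \<noteq> 0 \<Longrightarrow> even (j + l)" for j
    using refl[of j] by (cases "even l"; cases "even j") auto
  then show ?thesis using that Q by blast
qed

section \<open>Pointwise and induced products\<close>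

definition part_sum :: "nat \<Rightarrow> (nat \<Rightarrow> rat) \<Rightarrow> partition \<Rightarrow> rat" where
  "part_sum K H lam = (\<Sum>m\<in>set_mset (parts lam). of_nat m ^ K * H (rmult m lam))"

definition Tprod :: "(nat \<times> nat) multiset \<Rightarrow> partition \<Rightarrow> rat" where
  "Tprod M = (\<lambda>x. \<Prod>p\<in>#M. Tfun (fst p) (snd p) x)"

text \<open>Filtration of the pointwise algebra by the number of factors; the two products will be
  compared modulo a lower step.\<close>

definition Tfilt :: "nat \<Rightarrow> (partition \<Rightarrow> rat) set" where
  "Tfilt n = F.span {Tprod M | M. (\<forall>p\<in>#M. valid_pair p) \<and> size M \<le> n}"

lemma Tprod_empty: "Tprod {#} = (\<lambda>_. 1)"
  by (simp add: Tprod_def)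

lemma Tprod_add_mset: "Tprod (add_mset p M) = Tf p * Tprod M"
  by (rule ext) (simp add: Tprod_def)

lemma Tprod_add_mset_apply: "Tprod (add_mset p M) lam = Tf p lam * Tprod M lam"
  by (simp add: Tprod_def)

lemma Tprod_in_Tfilt: "(\<And>p. p \<in># M \<Longrightarrow> valid_pair p) \<Longrightarrow> size M \<le> n \<Longrightarrow> Tprod M \<in> Tfilt n"
  unfolding Tfilt_def by (rule F.span_base) blast

lemma Tfilt_mono: "f \<in> Tfilt m \<Longrightarrow> m \<le> n \<Longrightarrow> f \<in> Tfilt n"
  unfolding Tfilt_def by (erule rev_subsetD, rule F.span_mono) auto

lemma Tfilt_subspace: "F.subspace (Tfilt n)"
  unfolding Tfilt_def by (rule F.subspace_span)

lemmas Tfilt_add = F.subspace_add[OF Tfilt_subspace]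
lemmas Tfilt_diff = F.subspace_diff[OF Tfilt_subspace]
lemmas Tfilt_scale = F.subspace_scale[OF Tfilt_subspace]
lemmas Tfilt_sum = F.subspace_sum[OF Tfilt_subspace]
lemmas Tfilt_zero = F.subspace_0[OF Tfilt_subspace]

lemma span_image_subset:
  assumes "\<And>f g. L (f + g) = L f + L g" "\<And>c f. L (fscale c f) = fscale c (L f)"
    and "F.subspace W" "\<And>f. f \<in> B \<Longrightarrow> L f \<in> W" "f \<in> F.span B"
  shows "L f \<in> W"
proof (rule F.span_induct[OF assms(5)])
  have "L 0 = 0" by (metis F.scale_zero_left assms(2))
  then show "F.subspace {x. L x \<in> W}"
    using assms(3) by (auto simp only: F.subspace_def assms(1,2) mem_Collect_eq)
qed (use assms(4) in blast)

lemma fscale_times: "f * fscale c g = fscale c (f * g)"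
  by (rule ext) (simp only: times_fun_apply fscale_def mult.left_commute)

lemma Tf_times_Tfilt:
  assumes "valid_pair p" "f \<in> Tfilt n"
  shows "Tf p * f \<in> Tfilt (Suc n)"
proof (rule span_image_subset[OF _ _ Tfilt_subspace _ assms(2)[unfolded Tfilt_def]])
  fix g assume "g \<in> {Tprod M | M. (\<forall>p\<in>#M. valid_pair p) \<and> size M \<le> n}"
  then obtain M where M: "g = Tprod M" "\<forall>p\<in>#M. valid_pair p" "size M \<le> n" by blast
  then show "Tf p * g \<in> Tfilt (Suc n)"
    using assms(1) unfolding M(1) Tprod_add_mset[symmetric] by (intro Tprod_in_Tfilt) auto
qed (simp_all only: fscale_times distrib_left)

lemma part_sum_faulhaber_in_Tfilt:
  assumes "l \<ge> 1" "even (K + l)"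
  shows "part_sum K (faulhaber l) \<in> Tfilt 1"
proof -
  have valid: "valid_pair (K, l)" using assms by (simp add: valid_pair_def)
  have "part_sum K (faulhaber l) = Tprod {#(K, l)#} - fscale (Tconst (K, l)) (Tprod {#})"
  proof
    fix lam
    show "part_sum K (faulhaber l) lam = (Tprod {#(K, l)#} - fscale (Tconst (K, l)) (Tprod {#})) lam"
      using Tf_eq[of "(K, l)" lam] by (simp add: part_sum_def Tprod_def fscale_def)
  qed
  moreover have "Tprod {#(K, l)#} - fscale (Tconst (K, l)) (Tprod {#}) \<in> Tfilt 1"
    using valid by (intro Tfilt_diff Tfilt_scale Tprod_in_Tfilt) auto
  ultimately show ?thesis by (simp only:)
qed

text \<open>Subtracting \<open>H 0 = 0\<close> replaces each power of r + 1/2 by its difference with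
  the power of 1/2, a combination of Faulhaber values whose index has the parity of the exponent.
  The parity of \<open>j + K\<close> thus becomes validity of the pairs.\<close>

lemma part_sum_in_Tfilt:
  assumes H: "\<And>r. H r = poly P (of_nat r + 1/2)" "H 0 = 0"
    and P: "\<And>j. coeff P j \<noteq> 0 \<Longrightarrow> even (j + K)"
  shows "part_sum K H \<in> Tfilt 1"
proof -
  have H_eq: "H r = (\<Sum>j\<le>degree P. \<Sum>i<j. (coeff P j * central_coeff j i) * faulhaber (Suc i) r)" for r
  proof -
    have "H r = H r - H 0" using H(2) by simp
    also have "\<dots> = (\<Sum>j\<le>degree P. coeff P j * ((of_nat r + 1/2) ^ j - (1/2) ^ j))"
      unfolding H(1) poly_altdef by (simp only: right_diff_distrib sum_subtractf of_nat_0 add_0_left)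
    also have "\<dots> = (\<Sum>j\<le>degree P. \<Sum>i<j. (coeff P j * central_coeff j i) * faulhaber (Suc i) r)"
      by (simp only: power_eq_sum_faulhaber sum_distrib_left mult.assoc)
    finally show ?thesis .
  qed
  have "part_sum K H = (\<Sum>j\<le>degree P. \<Sum>i<j. fscale (coeff P j * central_coeff j i) (part_sum K (faulhaber (Suc i))))"
  proof
    fix lam
    have "part_sum K H lam = (\<Sum>m\<in>set_mset (parts lam). \<Sum>j\<le>degree P. \<Sum>i<j.
        (coeff P j * central_coeff j i) * (of_nat m ^ K * faulhaber (Suc i) (rmult m lam)))"
      unfolding part_sum_def H_eq
      by (simp only: sum_distrib_left mult.left_commute[of "of_nat _ ^ K"])
    also have "\<dots> = (\<Sum>j\<le>degree P. \<Sum>i<j. \<Sum>m\<in>set_mset (parts lam).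
        (coeff P j * central_coeff j i) * (of_nat m ^ K * faulhaber (Suc i) (rmult m lam)))"
      by (subst sum.swap, rule sum.cong[OF refl], rule sum.swap)
    also have "\<dots> = (\<Sum>j\<le>degree P. \<Sum>i<j. fscale (coeff P j * central_coeff j i) (part_sum K (faulhaber (Suc i)))) lam"
      by (simp only: fun_sum_apply fscale_def part_sum_def sum_distrib_left)
    finally show "part_sum K H lam = \<dots>" .
  qed
  moreover have "fscale (coeff P j * central_coeff j i) (part_sum K (faulhaber (Suc i))) \<in> Tfilt 1" if "i < j" for i j
  proof (cases "coeff P j * central_coeff j i = 0")
    case True
    then show ?thesis using Tfilt_zero by (simp only: F.scale_zero_left)
  next
    case False
    then have "even (j + K)" using P[of j] by force
    moreover from False have "odd (j - i)" by (auto simp: central_coeff_def split: if_splits)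
    ultimately have "even (K + Suc i)" using \<open>i < j\<close> by presburger
    then show ?thesis by (intro Tfilt_scale part_sum_faulhaber_in_Tfilt) auto
  qed
  ultimately show ?thesis by (auto intro!: Tfilt_sum)
qed

text \<open>Polynomials in \<open>s\<close> and \<open>r + 1/2\<close> that are divisible by \<open>s\<close> and have total degree parity \<open>e\<close>.\<close>

inductive parity_poly :: "nat \<Rightarrow> (nat \<Rightarrow> nat \<Rightarrow> rat) \<Rightarrow> bool" where
  zero: "parity_poly e (\<lambda>s r. 0)"
| monom: "a \<ge> 1 \<Longrightarrow> even (a + b + e) \<Longrightarrow> parity_poly e (\<lambda>s r. of_nat s ^ a * (of_nat r + 1/2) ^ b)"
| add: "parity_poly e G \<Longrightarrow> parity_poly e H \<Longrightarrow> parity_poly e (\<lambda>s r. G s r + H s r)"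
| scale: "parity_poly e G \<Longrightarrow> parity_poly e (\<lambda>s r. c * G s r)"

lemma parity_poly_sum:
  "(\<And>x. x \<in> A \<Longrightarrow> parity_poly e (G x)) \<Longrightarrow> parity_poly e (\<lambda>s r. \<Sum>x\<in>A. G x s r)"
proof (induction A rule: infinite_finite_induct)
  case (insert x A)
  then show ?case by (simp add: parity_poly.add)
qed (simp_all add: parity_poly.zero)

lemma parity_poly_power_mult:
  assumes "parity_poly e G"
  shows "parity_poly (a + b + e) (\<lambda>s r. of_nat s ^ a * (of_nat r + 1/2) ^ b * G s r)"
  using assms
proof induction
  case (zero e)
  then show ?case by (simp add: parity_poly.zero)
next
  case (monom a' b' e)
  have "parity_poly (a + b + e) (\<lambda>s r. of_nat s ^ (a + a') * (of_nat r + 1/2) ^ (b + b'))"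
    using monom by (intro parity_poly.monom) auto
  then show ?case by (simp add: power_add mult_ac)
next
  case (add e G H)
  show ?case using parity_poly.add[OF add.IH] by (simp only: distrib_left)
next
  case (scale e G c)
  show ?case using parity_poly.scale[OF scale.IH] by (simp only: mult.left_commute)
qed

lemma parity_poly_cong: "parity_poly e G \<Longrightarrow> even (e + e') \<Longrightarrow> parity_poly e' G"
proof (induction rule: parity_poly.induct)
  case (monom a b e)
  then have "even (a + b + e')" by presburger
  with monom(1) show ?case by (rule parity_poly.monom)
qed (simp_all add: parity_poly.intros)

lemma parity_poly_mult:
  assumes "parity_poly e G" "parity_poly e' H"
  shows "parity_poly (e + e') (\<lambda>s r. G s r * H s r)"
  using assms
proof induction
  case (zero e)
  then show ?case by (simp add: parity_poly.zero)
next
  case (monom a b e)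
  show ?case
    by (rule parity_poly_cong[OF parity_poly_power_mult[OF monom(3)]]) (use monom(2) in presburger)
next
  case (add e G G')
  show ?case using parity_poly.add[OF add.IH] add.prems by (simp only: distrib_right)
next
  case (scale e G c)
  show ?case using parity_poly.scale[OF scale.IH] scale.prems by (simp only: mult.assoc)
qed

text \<open>In the binomial expansion the term free of \<open>s\<close> cancels, which gives
  divisibility by \<open>s\<close>.\<close>

lemma parity_poly_power_diff:
  "parity_poly j (\<lambda>s r. (of_nat r + 1/2 - of_nat s) ^ j - (of_nat r + 1/2) ^ j)"
proof -
  have "(x - y) ^ j - x ^ j = (\<Sum>i=1..j. (of_nat (j choose i) * (-1) ^ i) * (y ^ i * x ^ (j - i)))" for x y :: rat
  proof -
    have "(x - y) ^ j = (\<Sum>i\<le>j. of_nat (j choose i) * (- y) ^ i * x ^ (j - i))"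
      using binomial_ring[of "- y" x j] by simp
    also have "\<dots> = (\<Sum>i\<le>j. (of_nat (j choose i) * (-1) ^ i) * (y ^ i * x ^ (j - i)))"
      by (subst power_minus) (simp only: mult.assoc)
    also have "{..j} = insert 0 {1..j}" by auto
    finally show ?thesis by simp
  qed
  moreover have "parity_poly j (\<lambda>s r. \<Sum>i=1..j. (of_nat (j choose i) * (-1) ^ i) * (of_nat s ^ i * (of_nat r + 1/2) ^ (j - i)))"
    by (intro parity_poly_sum parity_poly.scale parity_poly.monom) auto
  ultimately show ?thesis by simp
qed

text \<open>Constant coefficients cancel in the difference, so the exception to parity at
  \<open>l = 1\<close> disappears.\<close>

lemma faulhaber_shift:
  assumes "l \<ge> 1"
  obtains D where "parity_poly l D" and "\<And>s r. s \<le> r \<Longrightarrow> faulhaber l (r - s) = faulhaber l r + D s r"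
proof -
  obtain Q where Q: "\<And>r. faulhaber l r = poly Q (of_nat r + 1/2)"
      "\<And>j. coeff Q j \<noteq> 0 \<Longrightarrow> even (j + l) \<or> (l = 1 \<and> j = 0)"
    using faulhaber_poly_parity[OF assms] by blast
  define D where "D = (\<lambda>s r. \<Sum>j\<le>degree Q. coeff Q j * ((of_nat r + 1/2 - of_nat s) ^ j - (of_nat r + 1/2) ^ j))"
  show ?thesis
  proof (rule that)
    have "parity_poly l (\<lambda>s r. coeff Q j * ((of_nat r + 1/2 - of_nat s) ^ j - (of_nat r + 1/2) ^ j))" for j
    proof (cases "coeff Q j = 0 \<or> j = 0")
      case True
      then show ?thesis by (auto simp: parity_poly.zero)
    next
      case False
      then have "even (j + l)" using Q(2) by blast
      then show ?thesis
        by (intro parity_poly.scale parity_poly_cong[OF parity_poly_power_diff])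
    qed
    then show "parity_poly l D" unfolding D_def by (rule parity_poly_sum)
    fix s r :: nat assume "s \<le> r"
    then have "(of_nat (r - s) + 1/2 :: rat) = of_nat r + 1/2 - of_nat s" by (simp add: of_nat_diff)
    then show "faulhaber l (r - s) = faulhaber l r + D s r"
      unfolding Q(1) D_def by (simp only: poly_altdef right_diff_distrib sum_subtractf)
  qed
qed

text \<open>Summing s^a over \<open>s\<close> gives the Faulhaber value of index
  \<open>Suc a\<close>. Divisibility by \<open>s\<close> means \<open>a \<ge> 1\<close>, which keeps
  away from the exceptional index 1.\<close>

lemma part_sum_parity_poly:
  assumes "parity_poly e G" "even (K + e + 1)"
  shows "part_sum K (\<lambda>r. \<Sum>s=1..r. G s r) \<in> Tfilt 1"
  using assms
proof induction
  case (zero e)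
  have "part_sum K (\<lambda>r. \<Sum>s=1..r. 0) = 0" by (rule ext) (simp add: part_sum_def)
  then show ?case using Tfilt_zero by (simp only:)
next
  case (monom a b e)
  obtain Q where Q: "\<And>r. faulhaber (Suc a) r = poly Q (of_nat r + 1/2)"
      "\<And>j. coeff Q j \<noteq> 0 \<Longrightarrow> even (j + Suc a) \<or> (Suc a = 1 \<and> j = 0)"
    using faulhaber_poly_parity[of "Suc a"] by auto
  show ?case
  proof (rule part_sum_in_Tfilt)
    show "(\<Sum>s=1..r. of_nat s ^ a * (of_nat r + 1/2) ^ b) = poly (monom 1 b * Q) (of_nat r + 1/2)" for r
      by (simp add: poly_monom Q(1)[symmetric] faulhaber_def sum_distrib_right[symmetric])
    show "even (j + K)" if "coeff (monom 1 b * Q) j \<noteq> 0" for j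
    proof -
      have "coeff Q (j - b) \<noteq> 0" "b \<le> j" using that by (auto simp: coeff_monom_mult split: if_splits)
      then have "even (j - b + Suc a)" "b \<le> j" using Q(2) monom(1) by force+
      then show ?thesis using monom(2,3) by presburger
    qed
  qed simp
next
  case (add e G H)
  have "part_sum K (\<lambda>r. \<Sum>s=1..r. G s r + H s r) =
      part_sum K (\<lambda>r. \<Sum>s=1..r. G s r) + part_sum K (\<lambda>r. \<Sum>s=1..r. H s r)"
    by (rule ext) (simp add: part_sum_def sum.distrib distrib_left)
  then show ?case using Tfilt_add[OF add.IH] add.prems by (simp only:)
next
  case (scale e G c)
  have "part_sum K (\<lambda>r. \<Sum>s=1..r. c * G s r) = fscale c (part_sum K (\<lambda>r. \<Sum>s=1..r. G s r))"
    by (rule ext) (simp add: part_sum_def fscale_def sum_distrib_left mult.left_commute)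
  then show ?case using Tfilt_scale[OF scale.IH] scale.prems by (simp only:)
qed

text \<open>Generalises the sum in \<open>odot_Tf\<close>: the weight may depend on the multiplicity
  too, as happens once factors of \<open>f\<close> are absorbed into it.\<close>

definition rect_sum :: "nat \<Rightarrow> (nat \<Rightarrow> nat \<Rightarrow> rat) \<Rightarrow> (partition \<Rightarrow> rat) \<Rightarrow> partition \<Rightarrow> rat" where
  "rect_sum K G f lam = (\<Sum>m\<in>set_mset (parts lam). \<Sum>s=1..rmult m lam.
     of_nat m ^ K * G s (rmult m lam) * f (lam - rect m s))"

lemma Tf_diff_rect:
  assumes D: "\<And>s r. s \<le> r \<Longrightarrow> faulhaber (snd p) (r - s) = faulhaber (snd p) r + D s r"
    and m: "m \<in># parts lam" and s: "s \<le> rmult m lam"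
  shows "Tf p (lam - rect m s) = Tf p lam + of_nat m ^ fst p * D s (rmult m lam)"
proof -
  have m0: "m > 0" using m by (rule parts_pos)
  define g where "g = (\<lambda>\<mu> m'. of_nat m' ^ fst p * faulhaber (snd p) (rmult m' \<mu>))"
  have sub: "set_mset (parts (lam - rect m s)) \<subseteq> set_mset (parts lam)"
    unfolding set_parts_diff_rect[OF m0] by auto
  \<comment> \<open>If all copies of \<open>m\<close> are removed, its summand is still harmless,
    because \<open>faulhaber\<close> vanishes at 0.\<close>
  have "sum (g (lam - rect m s)) (set_mset (parts (lam - rect m s))) = sum (g (lam - rect m s)) (set_mset (parts lam))"
  proof (rule sum.mono_neutral_left[OF _ sub])
    show "\<forall>i\<in>set_mset (parts lam) - set_mset (parts (lam - rect m s)). g (lam - rect m s) i = 0"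
      by (simp add: g_def rmult_def not_in_iff del: parts_minus)
  qed simp
  also have "\<dots> = g (lam - rect m s) m + sum (g (lam - rect m s)) (set_mset (parts lam) - {m})"
    by (rule sum.remove) (use m in auto)
  also have "sum (g (lam - rect m s)) (set_mset (parts lam) - {m}) = sum (g lam) (set_mset (parts lam) - {m})"
    by (rule sum.cong[OF refl]) (simp add: g_def rmult_diff_rect[OF m0])
  also have "g (lam - rect m s) m = of_nat m ^ fst p * D s (rmult m lam) + g lam m"
    using s by (simp add: g_def rmult_diff_rect[OF m0] D distrib_left)
  also have "of_nat m ^ fst p * D s (rmult m lam) + g lam m + sum (g lam) (set_mset (parts lam) - {m}) =
      of_nat m ^ fst p * D s (rmult m lam) + sum (g lam) (set_mset (parts lam))"
    using m by (simp add: sum.remove[of _ m])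
  finally show ?thesis by (simp only: Tf_eq g_def)
qed

text \<open>The factor \<open>Tf p\<close> at the reduced partition is its value at
  \<open>lam\<close>, which can be pulled out, plus a shift, which is absorbed into the
  weight.\<close>

lemma rect_sum_Tprod_add_mset:
  assumes D: "\<And>s r. s \<le> r \<Longrightarrow> faulhaber (snd p) (r - s) = faulhaber (snd p) r + D s r"
  shows "rect_sum K G (Tprod (add_mset p M)) =
     Tf p * rect_sum K G (Tprod M) + rect_sum (K + fst p) (\<lambda>s r. G s r * D s r) (Tprod M)"
proof
  fix lam
  have "rect_sum K G (Tprod (add_mset p M)) lam = (\<Sum>m\<in>set_mset (parts lam). \<Sum>s=1..rmult m lam.
      Tf p lam * (of_nat m ^ K * G s (rmult m lam) * Tprod M (lam - rect m s)) +
      of_nat m ^ (K + fst p) * (G s (rmult m lam) * D s (rmult m lam)) * Tprod M (lam - rect m s))"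
    unfolding rect_sum_def
  proof (intro sum.cong refl)
    fix m s assume "m \<in># parts lam" "s \<in> {1..rmult m lam}"
    then have "Tf p (lam - rect m s) = Tf p lam + of_nat m ^ fst p * D s (rmult m lam)"
      by (intro Tf_diff_rect[OF D]) auto
    then show "of_nat m ^ K * G s (rmult m lam) * Tprod (add_mset p M) (lam - rect m s) =
       Tf p lam * (of_nat m ^ K * G s (rmult m lam) * Tprod M (lam - rect m s)) +
      of_nat m ^ (K + fst p) * (G s (rmult m lam) * D s (rmult m lam)) * Tprod M (lam - rect m s)"
      by (simp add: Tprod_add_mset_apply power_add algebra_simps)
  qed
  then show "rect_sum K G (Tprod (add_mset p M)) lam =
     (Tf p * rect_sum K G (Tprod M) + rect_sum (K + fst p) (\<lambda>s r. G s r * D s r) (Tprod M)) lam"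
    by (simp only: plus_fun_apply times_fun_apply rect_sum_def sum.distrib sum_distrib_left)
qed

text \<open>Pulling out a factor costs one filtration step; absorbing its shift adds
  \<open>fst p\<close> to \<open>K\<close> and \<open>snd p\<close> to the parity, an even total.
  The sum left at the end counts as one factor.\<close>

lemma rect_sum_in_Tfilt:
  assumes "\<forall>p\<in>#M. valid_pair p" "parity_poly e G" "even (K + e + 1)"
  shows "rect_sum K G (Tprod M) \<in> Tfilt (Suc (size M))"
  using assms
proof (induction M arbitrary: K e G)
  case empty
  have "rect_sum K G (Tprod {#}) = part_sum K (\<lambda>r. \<Sum>s=1..r. G s r)"
    by (rule ext) (simp add: rect_sum_def part_sum_def Tprod_empty sum_distrib_left)
  then show ?case using part_sum_parity_poly[OF empty(2,3)] by simp
next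
  case (add p M)
  have p: "snd p \<ge> 1" "even (fst p + snd p)" "valid_pair p"
    using add.prems(1) by (auto simp: valid_pair_def)
  obtain D where D: "parity_poly (snd p) D"
      "\<And>s r. s \<le> r \<Longrightarrow> faulhaber (snd p) (r - s) = faulhaber (snd p) r + D s r"
    using faulhaber_shift[OF p(1)] by blast
  have M: "\<forall>p\<in>#M. valid_pair p" using add.prems(1) by simp
  have "Tf p * rect_sum K G (Tprod M) \<in> Tfilt (Suc (Suc (size M)))"
    by (rule Tf_times_Tfilt[OF p(3) add.IH[OF M add.prems(2,3)]])
  moreover have "rect_sum (K + fst p) (\<lambda>s r. G s r * D s r) (Tprod M) \<in> Tfilt (Suc (Suc (size M)))"
    by (rule Tfilt_mono[OF _ le_SucI[OF order_refl]], rule add.IH[OF M parity_poly_mult[OF add.prems(2) D(1)]]) (use add.prems(3) p(2) in presburger)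
  moreover have "rect_sum K G (Tprod (add_mset p M)) =
     Tf p * rect_sum K G (Tprod M) + rect_sum (K + fst p) (\<lambda>s r. G s r * D s r) (Tprod M)"
    by (rule rect_sum_Tprod_add_mset) (rule D(2))
  ultimately show ?case
    by (simp only: size_add_mset Tfilt_add)
qed

text \<open>Pulling all factors out of the sum leaves the pointwise product. Every correction has
  absorbed at least one factor into its weight and so lies one step lower.\<close>

lemma odot_Tf_Tprod:
  assumes p: "valid_pair p" and M: "\<forall>q\<in>#M. valid_pair q"
  shows "odot (Tf p) (Tprod M) - Tf p * Tprod M \<in> Tfilt (size M)"
proof -
  let ?G = "\<lambda>s r. of_nat s ^ (snd p - 1) :: rat"
  have "rect_sum (fst p) ?G (Tprod M) - (Tf p - (\<lambda>_. Tconst p)) * Tprod M \<in> Tfilt (size M)"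
    using M
  proof (induction M)
    case empty
    have "rect_sum (fst p) ?G (Tprod {#}) - (Tf p - (\<lambda>_. Tconst p)) * Tprod {#} = 0"
      by (rule ext) (simp add: rect_sum_def Tprod_empty Tf_eq faulhaber_def sum_distrib_left)
    then show ?case using Tfilt_zero by (simp only:)
  next
    case (add q M)
    have q: "snd q \<ge> 1" "even (fst q + snd q)" "valid_pair q"
      using add.prems by (auto simp: valid_pair_def)
    have M: "\<forall>p\<in>#M. valid_pair p" using add.prems(1) by simp
    obtain D where D: "parity_poly (snd q) D"
        "\<And>s r. s \<le> r \<Longrightarrow> faulhaber (snd q) (r - s) = faulhaber (snd q) r + D s r"
      using faulhaber_shift[OF q(1)] by blast
    let ?E = "rect_sum (fst p) ?G (Tprod M) - (Tf p - (\<lambda>_. Tconst p)) * Tprod M"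
    let ?R = "rect_sum (fst p + fst q) (\<lambda>s r. ?G s r * D s r) (Tprod M)"
    have "rect_sum (fst p) ?G (Tprod (add_mset q M)) - (Tf p - (\<lambda>_. Tconst p)) * Tprod (add_mset q M) = Tf q * ?E + ?R"
    proof -
      have "rect_sum (fst p) ?G (Tprod (add_mset q M)) = Tf q * rect_sum (fst p) ?G (Tprod M) + ?R"
        by (rule rect_sum_Tprod_add_mset) (rule D(2))
      then show ?thesis unfolding Tprod_add_mset by (simp only:) (simp only: algebra_simps)
    qed
    moreover have "Tf q * ?E \<in> Tfilt (Suc (size M))"
      by (rule Tf_times_Tfilt[OF q(3) add.IH[OF M]])
    moreover have "?R \<in> Tfilt (Suc (size M))"
    proof (rule rect_sum_in_Tfilt[OF M])
      \<comment> \<open>The weight \<open>?G\<close> may have exponent 0 and so fail divisibility by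
        \<open>s\<close>; the factor \<open>D\<close> supplies it.\<close>
      show "parity_poly (snd p - 1 + 0 + snd q) (\<lambda>s r. ?G s r * D s r)"
        using parity_poly_power_mult[OF D(1), of "snd p - 1" 0] by simp
      show "even (fst p + fst q + (snd p - 1 + 0 + snd q) + 1)"
        using q(2) p by (simp add: valid_pair_def)
    qed
    ultimately show ?case by (simp only: size_add_mset Tfilt_add)
  qed
  moreover have "odot (Tf p) (Tprod M) - Tf p * Tprod M = rect_sum (fst p) ?G (Tprod M) - (Tf p - (\<lambda>_. Tconst p)) * Tprod M"
    by (rule ext) (simp add: odot_Tf rect_sum_def Tweight_def algebra_simps)
  ultimately show ?thesis by (simp only:)
qed

lemma TT_eq: "TT = F.span {Tprod M | M. \<forall>p\<in>#M. valid_pair p}"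
  by (simp only: TT_def Tprod_def)

text \<open>By \<open>odot_Tf_Tprod\<close> multiplying by a generator pointwise or by
  \<open>odot\<close> agrees modulo fewer factors, so each family is expressed in the other by
  induction on the number of factors.\<close>

lemma span_Tbasis_eq_TT: "F.span (Tbasis ` {M. \<forall>p\<in>#M. valid_pair p}) = TT"
proof (rule antisym)
  let ?U = "F.span (Tbasis ` {M. \<forall>p\<in>#M. valid_pair p})"
  have odot_filt: "odot (Tf p) f \<in> Tfilt (Suc n)" if p: "valid_pair p" and f: "f \<in> Tfilt n" for p f n
  proof (rule span_image_subset[OF odot_add_right odot_scale_right Tfilt_subspace _ f[unfolded Tfilt_def]])
    fix g assume "g \<in> {Tprod M | M. (\<forall>p\<in>#M. valid_pair p) \<and> size M \<le> n}"
    then obtain M where M: "g = Tprod M" "\<forall>p\<in>#M. valid_pair p" "size M \<le> n" by blast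
    have "odot (Tf p) g - Tf p * g \<in> Tfilt (Suc n)"
      unfolding M(1) by (rule Tfilt_mono[OF odot_Tf_Tprod[OF p M(2)]]) (use M(3) in simp)
    moreover have "Tf p * g \<in> Tfilt (Suc n)"
      unfolding M(1) by (rule Tf_times_Tfilt[OF p Tprod_in_Tfilt]) (use M in auto)
    ultimately show "odot (Tf p) g \<in> Tfilt (Suc n)" using Tfilt_add by (metis diff_add_cancel)
  qed
  have Tbasis_Tfilt: "Tbasis M \<in> Tfilt (size M)" if "\<forall>p\<in>#M. valid_pair p" for M
    using that
  proof (induction M)
    case empty
    then show ?case using Tprod_in_Tfilt[of "{#}" 0] by (simp add: Tprod_empty)
  next
    case (add p M)
    then show ?case unfolding Tbasis_add_mset size_add_mset by (intro odot_filt) auto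
  qed
  have Tfilt_TT: "Tfilt n \<subseteq> TT" for n
    unfolding Tfilt_def TT_eq by (rule F.span_mono) auto
  have "Tbasis ` {M. \<forall>p\<in>#M. valid_pair p} \<subseteq> TT"
  proof (rule image_subsetI)
    fix M :: "(nat \<times> nat) multiset" assume "M \<in> {M. \<forall>p\<in>#M. valid_pair p}"
    then have "\<forall>p\<in>#M. valid_pair p" by simp
    from Tbasis_Tfilt[OF this] show "Tbasis M \<in> TT" by (rule subsetD[OF Tfilt_TT])
  qed
  then show "?U \<subseteq> TT" unfolding TT_eq by (intro F.span_minimal F.subspace_span)
  have odot_U: "odot (Tf p) f \<in> ?U" if p: "valid_pair p" and f: "f \<in> ?U" for p f
  proof (rule span_image_subset[OF odot_add_right odot_scale_right F.subspace_span _ f])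
    fix g assume "g \<in> Tbasis ` {M. \<forall>p\<in>#M. valid_pair p}"
    then obtain M where M: "g = Tbasis M" "\<forall>p\<in>#M. valid_pair p" by blast
    show "odot (Tf p) g \<in> ?U"
      unfolding M(1) Tbasis_add_mset[symmetric] by (intro F.span_base imageI) (use M(2) p in simp)
  qed
  have Tfilt_U: "Tfilt n \<subseteq> ?U" for n
  proof (induction n)
    case 0
    have "{Tprod M | M. (\<forall>p\<in>#M. valid_pair p) \<and> size M \<le> 0} \<subseteq> Tbasis ` {M. \<forall>p\<in>#M. valid_pair p}"
    proof (rule subsetI)
      fix f assume "f \<in> {Tprod M | M. (\<forall>p\<in>#M. valid_pair p) \<and> size M \<le> 0}"
      then have "f = Tbasis {#}" by (auto simp: Tprod_empty)
      then show "f \<in> Tbasis ` {M. \<forall>p\<in>#M. valid_pair p}"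
        by (rule image_eqI) simp
    qed
    then show ?case unfolding Tfilt_def by (rule F.span_mono)
  next
    case (Suc n)
    have "Tprod M \<in> ?U" if M: "\<forall>p\<in>#M. valid_pair p" "size M \<le> Suc n" for M
    proof (cases M)
      case empty
      then show ?thesis by (intro subsetD[OF Suc Tprod_in_Tfilt]) simp_all
    next
      case (add p N)
      have pN: "valid_pair p" "\<forall>p\<in>#N. valid_pair p" "size N \<le> n" using M add by auto
      have "Tprod N \<in> ?U" by (rule subsetD[OF Suc Tprod_in_Tfilt]) (use pN in simp_all)
      then have "odot (Tf p) (Tprod N) \<in> ?U" by (rule odot_U[OF pN(1)])
      moreover have "odot (Tf p) (Tprod N) - Tf p * Tprod N \<in> ?U"
        by (rule subsetD[OF Suc Tfilt_mono[OF odot_Tf_Tprod[OF pN(1,2)] pN(3)]])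
      ultimately have "odot (Tf p) (Tprod N) - (odot (Tf p) (Tprod N) - Tf p * Tprod N) \<in> ?U"
        by (rule F.span_diff)
      then show ?thesis unfolding add Tprod_add_mset by (simp only: diff_diff_eq2 add_diff_cancel_left')
    qed
    then show ?case unfolding Tfilt_def[of "Suc n"]
      by (intro F.span_minimal F.subspace_span) blast
  qed
  have "Tprod M \<in> ?U" if "\<forall>p\<in>#M. valid_pair p" for M
    by (rule subsetD[OF Tfilt_U Tprod_in_Tfilt[OF _ order_refl]]) (use that in simp)
  then show "TT \<subseteq> ?U" unfolding TT_eq by (intro F.span_minimal F.subspace_span) blast
qed

section \<open>The symmetric subspace\<close>

definition odot_alg :: "(nat \<times> nat) set \<Rightarrow> (partition \<Rightarrow> rat) set" where
  "odot_alg P = F.span (Tbasis ` {M. set_mset M \<subseteq> P})"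

lemma odot_alg_subspace: "F.subspace (odot_alg P)"
  unfolding odot_alg_def by (rule F.subspace_span)

lemmas odot_alg_add = F.subspace_add[OF odot_alg_subspace]
lemmas odot_alg_zero = F.subspace_0[OF odot_alg_subspace]

lemma odot_alg_mono: "P \<subseteq> P' \<Longrightarrow> odot_alg P \<subseteq> odot_alg P'"
  unfolding odot_alg_def by (rule F.span_mono) auto

lemma Tbasis_in_odot_alg: "set_mset M \<subseteq> P \<Longrightarrow> Tbasis M \<in> odot_alg P"
  unfolding odot_alg_def by (rule F.span_base) auto

lemma one_in_odot_alg: "(\<lambda>_. 1) \<in> odot_alg P"
  using Tbasis_in_odot_alg[of "{#}" P] by simp

lemma Tf_in_odot_alg: "p \<in> P \<Longrightarrow> Tf p \<in> odot_alg P"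
  using Tbasis_in_odot_alg[of "{#p#}" P] by (simp add: Tbasis_add_mset)

lemma odot_in_span:
  assumes "\<And>f g. f \<in> B \<Longrightarrow> g \<in> B \<Longrightarrow> odot f g \<in> F.span B" "f \<in> F.span B" "g \<in> F.span B"
  shows "odot f g \<in> F.span B"
proof (rule span_image_subset[where L = "\<lambda>f. odot f g", OF odot_add_left odot_scale_left F.subspace_span _ assms(2)])
  fix f assume f: "f \<in> B"
  show "odot f g \<in> F.span B"
    by (rule span_image_subset[OF odot_add_right odot_scale_right F.subspace_span assms(1)[OF f] assms(3)])
qed

lemma odot_in_odot_alg: "f \<in> odot_alg P \<Longrightarrow> g \<in> odot_alg P \<Longrightarrow> odot f g \<in> odot_alg P"
  unfolding odot_alg_def
proof (rule odot_in_span)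
  fix f g assume "f \<in> Tbasis ` {M. set_mset M \<subseteq> P}" "g \<in> Tbasis ` {M. set_mset M \<subseteq> P}"
  then obtain M N where MN: "f = Tbasis M" "g = Tbasis N" "set_mset M \<subseteq> P" "set_mset N \<subseteq> P" by blast
  then show "odot f g \<in> F.span (Tbasis ` {M. set_mset M \<subseteq> P})"
    unfolding MN(1,2) Tbasis_plus[symmetric] by (intro F.span_base imageI) simp
qed

section \<open>The derivations attached to power sums of the parts\<close>

definition power_sum :: "nat \<Rightarrow> partition \<Rightarrow> rat" where
  "power_sum k lam = (\<Sum>m\<in>#parts lam. of_nat m ^ k)"

lemma power_sum_zero [simp]: "power_sum k 0 = 0"
  by (simp add: power_sum_def)

lemma power_sum_plus: "power_sum k (\<mu> + \<nu>) = power_sum k \<mu> + power_sum k \<nu>"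
  by (simp add: power_sum_def)

lemma Tf_one_eq: "Tf (k, 1) = fscale (Tconst (k, 1)) Zser + power_sum k"
proof
  fix lam
  have "power_sum k lam = (\<Sum>m\<in>set_mset (parts lam). of_nat m ^ k * faulhaber 1 (rmult m lam))"
    unfolding power_sum_def
    by (subst sum_mset_eq_sum_count[of "set_mset (parts lam)"]) (simp_all add: faulhaber_def rmult_def mult.commute)
  then show "Tf (k, 1) lam = (fscale (Tconst (k, 1)) Zser + power_sum k) lam"
    using Tf_eq[of "(k, 1)" lam] by (simp only: fst_conv snd_conv plus_fun_apply fscale_def Zser_def mult_1_right)
qed

text \<open>\<open>power_sum k\<close> is additive on partitions, so it acts on monomials like a
  degree.\<close>

lemma power_sum_derivation:
  "power_sum k * ser_mult A B = ser_mult (power_sum k * A) B + ser_mult A (power_sum k * B)"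
proof
  fix lam
  have "(power_sum k * ser_mult A B) lam = (\<Sum>(\<mu>, \<nu>)\<in>{(\<mu>, \<nu>). \<mu> + \<nu> = lam}. power_sum k lam * (A \<mu> * B \<nu>))"
    by (simp add: ser_mult_eq sum_distrib_left case_prod_unfold)
  also have "\<dots> = (\<Sum>(\<mu>, \<nu>)\<in>{(\<mu>, \<nu>). \<mu> + \<nu> = lam}.
      (power_sum k * A) \<mu> * B \<nu> + A \<mu> * (power_sum k * B) \<nu>)"
    by (rule sum.cong) (auto simp: power_sum_plus algebra_simps)
  also have "\<dots> = (ser_mult (power_sum k * A) B + ser_mult A (power_sum k * B)) lam"
    by (simp add: ser_mult_eq sum.distrib case_prod_unfold)
  finally show "(power_sum k * ser_mult A B) lam = \<dots>" .
qed

text \<open>Transports the Euler-type operator sum of m^k u_m d/du_m from brackets to functions;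
  each monomial is an eigenvector with eigenvalue \<open>power_sum k\<close>.\<close>

definition euler_deriv :: "nat \<Rightarrow> (partition \<Rightarrow> rat) \<Rightarrow> partition \<Rightarrow> rat" where
  "euler_deriv k f = ser_mult (power_sum k * ubracket f) Zser"

lemma ubracket_euler_deriv: "ubracket (euler_deriv k f) = power_sum k * ubracket f"
  by (simp add: euler_deriv_def)

text \<open>Apply the derivation rule to \<open>f\<close> written as its bracket times
  \<open>Zser\<close>. The derivative of the bracket gives \<open>euler_deriv\<close>; the
  derivative of \<open>Zser\<close> is \<open>power_sum k\<close>, which with the constant term
  makes up the induced product.\<close>

lemma times_Tf_one: "Tf (k, 1) * f = odot (Tf (k, 1)) f + euler_deriv k f"
proof -
  let ?c = "Tconst (k, 1)"
  have "power_sum k * f = power_sum k * ser_mult (ubracket f) Zser"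
    by (simp only: ser_mult_ubracket)
  also have "\<dots> = euler_deriv k f + ser_mult (ubracket f) (power_sum k * Zser)"
    by (simp only: power_sum_derivation euler_deriv_def)
  also have "power_sum k * Zser = power_sum k" by (rule ext) (simp add: Zser_def)
  finally have 1: "power_sum k * f = euler_deriv k f + ser_mult (ubracket f) (power_sum k)" .
  have "odot (Tf (k, 1)) f = odot f (Tf (k, 1))" by (rule odot_commute)
  also have "\<dots> = fscale ?c f + ser_mult (ubracket f) (power_sum k)"
    by (simp only: odot_eq Tf_one_eq ser_mult_add_right ser_mult_scale_right ser_mult_ubracket)
  finally have 2: "odot (Tf (k, 1)) f = fscale ?c f + ser_mult (ubracket f) (power_sum k)" .
  have "Tf (k, 1) * f = fscale ?c f + power_sum k * f"
    by (rule ext) (simp only: Tf_one_eq plus_fun_apply times_fun_apply fscale_def Zser_def distrib_right mult_1_right)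
  then show ?thesis unfolding 1 2 by (simp only: add_ac)
qed

lemma euler_deriv_add: "euler_deriv k (f + g) = euler_deriv k f + euler_deriv k g"
  by (simp only: euler_deriv_def ubracket_add distrib_left ser_mult_add_left)

lemma euler_deriv_scale: "euler_deriv k (fscale c f) = fscale c (euler_deriv k f)"
  by (simp only: euler_deriv_def ubracket_scale fscale_times ser_mult_scale_left)

lemma euler_deriv_odot: "euler_deriv k (odot f g) = odot (euler_deriv k f) g + odot f (euler_deriv k g)"
  by (subst ubracket_inject[symmetric])
     (simp only: ubracket_euler_deriv ubracket_odot ubracket_add power_sum_derivation)

lemma euler_deriv_one: "euler_deriv k (\<lambda>_. 1) = 0"
proof -
  have "power_sum k * ser_one = 0" by (rule ext) (simp add: ser_one_def)
  then show ?thesis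
    by (subst ubracket_inject[symmetric]) (simp only: ubracket_euler_deriv ubracket_one ubracket_zero)
qed

text \<open>At u_m^s the eigenvalue is s m^k, which raises both exponents of the weight. At the
  empty partition it is 0, matching \<open>Tconst (a + k, Suc l) = 0\<close>.\<close>

lemma euler_deriv_Tf:
  assumes "k \<ge> 1" "l \<ge> 1"
  shows "euler_deriv k (Tf (a, l)) = Tf (a + k, Suc l)"
proof -
  have "(power_sum k * rect_ser (Tconst (a, l)) (Tweight (a, l))) \<mu> =
      rect_ser (Tconst (a + k, Suc l)) (Tweight (a + k, Suc l)) \<mu>" for \<mu>
  proof (cases "\<mu> = 0")
    case True
    have "Tconst (a + k, Suc l) = 0" using assms by (simp add: Tconst_def kdelta_def)
    then show ?thesis by (simp only: True times_fun_apply power_sum_zero rect_ser_zero mult_zero_left)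
  next
    case False
    show ?thesis
    proof (cases "\<exists>m s. m > 0 \<and> s > 0 \<and> \<mu> = rect m s")
      case True
      then obtain m s where ms: "m > 0" "s > 0" "\<mu> = rect m s" by blast
      have "power_sum k \<mu> = of_nat s * of_nat m ^ k"
        by (simp add: power_sum_def ms parts_rect)
      moreover have "of_nat s * of_nat s ^ (l - 1) = (of_nat s ^ l :: rat)"
        using assms(2) by (cases l) simp_all
      ultimately show ?thesis
        using ms(1,2) by (simp add: ms(3) Tweight_def power_add mult_ac)
    next
      case False
      then have "rect_ser c h \<mu> = 0" for c h
        by (intro rect_ser_cases \<open>\<mu> \<noteq> 0\<close>) blast
      then show ?thesis by simp
    qed
  qed
  then have "power_sum k * rect_ser (Tconst (a, l)) (Tweight (a, l)) =
      rect_ser (Tconst (a + k, Suc l)) (Tweight (a + k, Suc l))" by blast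
  then show ?thesis
    by (subst ubracket_inject[symmetric])
       (simp only: ubracket_euler_deriv ubracket_Tf[of "(a, l)", simplified fst_conv snd_conv]
          ubracket_Tf[of "(a + k, Suc l)", simplified fst_conv snd_conv] fst_conv snd_conv)
qed

text \<open>By the Leibniz rule it suffices to follow single generators. Source and target pairs are
  kept separate so that a bound on the second index may grow by one.\<close>

lemma euler_deriv_in_odot_alg:
  assumes "k \<ge> 1" "P \<subseteq> P'" "\<And>a l. (a, l) \<in> P \<Longrightarrow> l \<ge> 1 \<and> (a + k, Suc l) \<in> P'"
    and "f \<in> odot_alg P"
  shows "euler_deriv k f \<in> odot_alg P'"
proof (rule span_image_subset[OF euler_deriv_add euler_deriv_scale odot_alg_subspace _
      assms(4)[unfolded odot_alg_def]])
  fix g assume "g \<in> Tbasis ` {M. set_mset M \<subseteq> P}"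
  then obtain M where M: "g = Tbasis M" "set_mset M \<subseteq> P" by blast
  have "euler_deriv k (Tbasis M) \<in> odot_alg P'"
    using M(2)
  proof (induction M)
    case empty
    show ?case by (simp only: Tbasis_empty euler_deriv_one odot_alg_zero)
  next
    case (add p M)
    obtain a l where p: "p = (a, l)" by (cases p)
    have in_P: "(a, l) \<in> P" "set_mset M \<subseteq> P" using add.prems p by auto
    have "Tf (a + k, Suc l) \<in> odot_alg P'" "Tf (a, l) \<in> odot_alg P'" "Tbasis M \<in> odot_alg P'"
      using assms(2) assms(3)[OF in_P(1)] in_P
      by (auto intro!: Tf_in_odot_alg[of "(_, _)", simplified] Tbasis_in_odot_alg)
    moreover have "euler_deriv k (Tf (a, l)) = Tf (a + k, Suc l)"
      using assms(1) assms(3)[OF in_P(1)] by (intro euler_deriv_Tf) auto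
    ultimately show ?case
      using add.IH[OF in_P(2)]
      by (simp only: p Tbasis_add_mset euler_deriv_odot odot_alg_add odot_in_odot_alg)
  qed
  then show "euler_deriv k g \<in> odot_alg P'" using M(1) by simp
qed

section \<open>Comparison with the space generated by the \<open>Sfun k\<close>\<close>

definition sym_pairs :: "(nat \<times> nat) set" where
  "sym_pairs = {p. valid_pair p \<and> snd p \<le> fst p}"

lemma sym_pairs_shift: "(a, l) \<in> sym_pairs \<Longrightarrow> odd k \<Longrightarrow> l \<ge> 1 \<and> (a + k, Suc l) \<in> sym_pairs"
  by (auto simp: sym_pairs_def valid_pair_def elim!: oddE)

definition Sprod :: "nat multiset \<Rightarrow> partition \<Rightarrow> rat" where
  "Sprod K = (\<lambda>x. \<Prod>k\<in>#K. Sfun k x)"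

lemma Sprod_add_mset: "Sprod (add_mset k K) = Tf (k - 1, 1) * Sprod K"
  by (rule ext) (simp add: Sprod_def Sfun_def)

lemma Sprod_empty: "Sprod {#} = (\<lambda>_. 1)"
  by (simp add: Sprod_def)

lemma SS_eq: "SS = F.span {Sprod K | K. \<forall>k\<in>#K. even k \<and> k \<ge> 2}"
  by (simp only: SS_def Sprod_def)

lemma Sprod_in_SS: "\<forall>k\<in>#K. even k \<and> k \<ge> 2 \<Longrightarrow> Sprod K \<in> SS"
  unfolding SS_eq by (rule F.span_base) blast

text \<open>Multiplication by \<open>Sfun k\<close> is an induced product plus a derivation by
  \<open>times_Tf_one\<close>, and as \<open>k - 1\<close> is odd both preserve the algebra on
  \<open>sym_pairs\<close>.\<close>

lemma SS_subset_odot_alg: "SS \<subseteq> odot_alg sym_pairs"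
proof -
  have "Sprod K \<in> odot_alg sym_pairs" if "\<forall>k\<in>#K. even k \<and> k \<ge> 2" for K
    using that
  proof (induction K)
    case empty
    show ?case by (simp only: Sprod_empty one_in_odot_alg)
  next
    case (add k K)
    have IH: "Sprod K \<in> odot_alg sym_pairs" using add by simp
    have k: "odd (k - 1)" "k - 1 \<ge> 1" using add.prems by auto
    have "(k - 1, 1) \<in> sym_pairs" using k by (simp add: sym_pairs_def valid_pair_def)
    then have "odot (Tf (k - 1, 1)) (Sprod K) \<in> odot_alg sym_pairs"
      by (rule odot_in_odot_alg[OF Tf_in_odot_alg IH])
    moreover have "euler_deriv (k - 1) (Sprod K) \<in> odot_alg sym_pairs"
      by (rule euler_deriv_in_odot_alg[OF k(2) order_refl sym_pairs_shift[OF _ k(1)] IH])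
    ultimately show ?case
      unfolding Sprod_add_mset times_Tf_one by (rule odot_alg_add)
  qed
  then show ?thesis unfolding SS_eq by (intro F.span_minimal odot_alg_subspace) blast
qed

lemma odot_list_in_SymS: "set fs \<subseteq> SS \<Longrightarrow> odot_list fs \<in> SymS"
  unfolding SymS_def by (rule F.span_base) blast

lemma SS_subset_SymS: "SS \<subseteq> SymS"
proof
  fix f assume "f \<in> SS"
  then have "odot_list [f] \<in> SymS" by (intro odot_list_in_SymS) simp
  then show "f \<in> SymS" by (simp add: odot_list_def)
qed

lemma odot_in_SymS: "f \<in> SymS \<Longrightarrow> g \<in> SymS \<Longrightarrow> odot f g \<in> SymS"
  unfolding SymS_def
proof (rule odot_in_span)
  fix f g assume "f \<in> {odot_list fs |fs. set fs \<subseteq> SS}" "g \<in> {odot_list fs |fs. set fs \<subseteq> SS}"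
  then obtain fs gs where *: "f = odot_list fs" "g = odot_list gs" "set fs \<subseteq> SS" "set gs \<subseteq> SS" by blast
  have "odot_list (fs @ gs) \<in> F.span {odot_list fs |fs. set fs \<subseteq> SS}"
    using odot_list_in_SymS[of "fs @ gs"] * unfolding SymS_def by simp
  then show "odot f g \<in> F.span {odot_list fs |fs. set fs \<subseteq> SS}"
    by (simp only: * odot_list_append)
qed

lemma SymS_subspace: "F.subspace SymS"
  unfolding SymS_def by (rule F.subspace_span)

lemma odot_alg_subset_SymS:
  assumes "\<And>p. p \<in> P \<Longrightarrow> Tf p \<in> SymS"
  shows "odot_alg P \<subseteq> SymS"
proof -
  have "Tbasis M \<in> SymS" if "set_mset M \<subseteq> P" for M
    using that
  proof (induction M)
    case empty
    have "odot_list [] \<in> SymS" by (rule odot_list_in_SymS) simp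
    then show ?case by (simp add: odot_list_def)
  next
    case (add p M)
    then show ?case unfolding Tbasis_add_mset by (intro odot_in_SymS assms) auto
  qed
  then show ?thesis unfolding odot_alg_def by (intro F.span_minimal SymS_subspace) blast
qed

lemma SymS_subset_odot_alg: "SymS \<subseteq> odot_alg sym_pairs"
proof -
  have "odot_list fs \<in> odot_alg sym_pairs" if "set fs \<subseteq> SS" for fs
    using that
  proof (induction fs)
    case Nil
    show ?case by (simp add: odot_list_def one_in_odot_alg)
  next
    case (Cons f fs)
    have "odot_list (f # fs) = odot f (odot_list fs)" by (simp add: odot_list_def)
    then show ?case
      using Cons SS_subset_odot_alg by (auto intro!: odot_in_odot_alg)
  qed
  then show ?thesis unfolding SymS_def by (intro F.span_minimal odot_alg_subspace) blast
qed

text \<open>Iterating \<^prop>\<open>Tf (1, 1) * f = odot (Tf (1, 1)) f + euler_deriv 1 f\<close>: each derivation raises the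
  second index by one, and only the term with all derivations on the initial factor reaches the top.\<close>

lemma Sprod_leading_term:
  assumes "odd a"
  shows "Sprod (add_mset (Suc a) (replicate_mset i 2)) - Tf (a + i, Suc i)
      \<in> odot_alg {p\<in>sym_pairs. snd p \<le> i}"
proof (induction i)
  case 0
  have "Sprod (add_mset (Suc a) (replicate_mset 0 2)) - Tf (a + 0, Suc 0) = 0"
    by (rule ext) (simp add: Sprod_def Sfun_def)
  then show ?case by (simp only: odot_alg_zero)
next
  case (Suc i)
  let ?A = "\<lambda>i. odot_alg {p\<in>sym_pairs. snd p \<le> i}"
  let ?P = "\<lambda>i. Sprod (add_mset (Suc a) (replicate_mset i 2))"
  define X where "X = ?P i - Tf (a + i, Suc i)"
  have a: "a \<ge> 1" using assms by (cases a) auto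
  have X: "X \<in> ?A i" using Suc by (simp only: X_def)
  have P: "?P i = Tf (a + i, Suc i) + X" by (simp only: X_def) simp
  \<comment> \<open>\<open>Sfun 2\<close> is \<open>Tf (1, 1)\<close>, so each further 2 applies
    \<open>times_Tf_one\<close> once.\<close>
  have "?P (Suc i) = Tf (1, 1) * ?P i"
    by (simp only: replicate_mset_Suc add_mset_commute[of "Suc a"] Sprod_add_mset[of 2]) simp
  also have "\<dots> = odot (Tf (1, 1)) (?P i) + (Tf (a + i + 1, Suc (Suc i)) + euler_deriv 1 X)"
  proof -
    have "euler_deriv 1 (Tf (a + i, Suc i)) = Tf (a + i + 1, Suc (Suc i))"
      by (rule euler_deriv_Tf) simp_all
    then have "euler_deriv 1 (?P i) = Tf (a + i + 1, Suc (Suc i)) + euler_deriv 1 X"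
      by (simp only: P euler_deriv_add)
    then show ?thesis by (simp only: times_Tf_one)
  qed
  finally have "?P (Suc i) - Tf (a + Suc i, Suc (Suc i)) = odot (Tf (1, 1)) (?P i) + euler_deriv 1 X"
    by simp
  moreover have "odot (Tf (1, 1)) (?P i) \<in> ?A (Suc i)"
  proof (intro odot_in_odot_alg)
    show "Tf (1, 1) \<in> ?A (Suc i)"
      by (rule Tf_in_odot_alg) (simp add: sym_pairs_def valid_pair_def)
    have "Tf (a + i, Suc i) \<in> ?A (Suc i)"
      by (rule Tf_in_odot_alg) (use assms a in \<open>simp add: sym_pairs_def valid_pair_def\<close>)
    moreover have "X \<in> ?A (Suc i)"
      by (rule subsetD[OF odot_alg_mono X]) auto
    ultimately show "?P i \<in> ?A (Suc i)" by (simp only: P odot_alg_add)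
  qed
  moreover have "euler_deriv 1 X \<in> ?A (Suc i)"
    by (rule euler_deriv_in_odot_alg[OF _ _ _ X]) (use sym_pairs_shift[of _ _ 1] in auto)
  ultimately show ?case by (simp only: odot_alg_add)
qed

text \<open>Induction on the second index: \<open>Sprod_leading_term\<close> writes
  \<open>Tf p\<close> as an element of \<open>SS\<close> minus induced products of generators with
  smaller second index.\<close>

lemma Tf_in_SymS: "p \<in> sym_pairs \<Longrightarrow> Tf p \<in> SymS"
proof (induction "snd p" arbitrary: p rule: less_induct)
  case less
  obtain b l where p: "p = (b, l)" by (cases p)
  \<comment> \<open>Chosen so that \<open>p = (a + i, Suc i)\<close>. Here a = b - l + 1 is positive
    by \<open>l \<le> b\<close> and odd because \<open>b + l\<close> is even.\<close>
  define i a where "i = l - 1" and "a = b - i"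
  have l: "1 \<le> l" "l \<le> b" "even (b + l)" using less.prems by (auto simp: p sym_pairs_def valid_pair_def)
  have eq: "p = (a + i, Suc i)" using l by (simp add: p a_def i_def)
  have "odd a" using l unfolding a_def i_def by presburger
  have "odot_alg {q\<in>sym_pairs. snd q \<le> i} \<subseteq> SymS"
    by (rule odot_alg_subset_SymS) (use less.hyps in \<open>simp add: eq less_Suc_eq_le\<close>)
  then have *: "Sprod (add_mset (Suc a) (replicate_mset i 2)) - Tf p \<in> SymS"
    using Sprod_leading_term[OF \<open>odd a\<close>, of i] by (auto simp only: eq)
  have "Sprod (add_mset (Suc a) (replicate_mset i 2)) \<in> SymS"
  proof -
    have "a \<ge> 1" using \<open>odd a\<close> by (cases a) auto
    then have "Sprod (add_mset (Suc a) (replicate_mset i 2)) \<in> SS"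
      using \<open>odd a\<close> by (intro Sprod_in_SS) (auto simp: in_replicate_mset)
    then show ?thesis using SS_subset_SymS by blast
  qed
  from F.subspace_diff[OF SymS_subspace this *]
  have "Sprod (add_mset (Suc a) (replicate_mset i 2)) -
      (Sprod (add_mset (Suc a) (replicate_mset i 2)) - Tf p) \<in> SymS" .
  then show ?case by (simp only: diff_diff_eq2 add_diff_cancel_left')
qed

lemma odot_alg_sym_pairs_eq_SymS: "odot_alg sym_pairs = SymS"
  using SymS_subset_odot_alg odot_alg_subset_SymS[OF Tf_in_SymS] by blast

theorem theorem4p3p1:
  defines "I \<equiv> {M :: (nat \<times> nat) multiset. \<forall>p\<in>#M. valid_pair p}"
      and "I' \<equiv> {M :: (nat \<times> nat) multiset. (\<forall>p\<in>#M. valid_pair p) \<and> (\<forall>p\<in>#M. fst p \<ge> snd p)}"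
  shows "inj_on Tbasis I \<and> \<not> module.dependent fscale (Tbasis ` I)
           \<and> module.span fscale (Tbasis ` I) = TT
         \<and> inj_on Tbasis I' \<and> \<not> module.dependent fscale (Tbasis ` I')
           \<and> module.span fscale (Tbasis ` I') = SymS"
proof -
  have "I' = {M. set_mset M \<subseteq> sym_pairs}"
    by (auto simp: I'_def sym_pairs_def)
  then have "F.span (Tbasis ` I') = SymS"
    using odot_alg_sym_pairs_eq_SymS by (simp only: odot_alg_def)
  moreover have "F.span (Tbasis ` I) = TT"
    unfolding I_def by (rule span_Tbasis_eq_TT)
  moreover have "snd p \<ge> 1" if "M \<in> I" "p \<in># M" for M p
    using that by (auto simp: I_def valid_pair_def)
  moreover have "snd p \<ge> 1" if "M \<in> I'" "p \<in># M" for M p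
    using that by (auto simp: I'_def valid_pair_def)
  ultimately show ?thesis
    by (intro conjI Tbasis_inj_independent)
qed

end
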